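(* Let $H$ be a complex Hilbert space and $K$ a finite-dimensional complex Hilbert space. Then $\mathcal{A}(C(H,K))$, the family of all admissible subsets of the metric space $(C(H,K),d)$, is compact; that is, every descending chain of nonempty members of $\mathcal{A}(C(H,K))$ has nonempty intersection.
   Context: $C(H,K)$ is the set of all closed densely-defined linear operators from $H$ to $K$. For $T,X\in C(H,K)$ put $L_T(X)=(I+T^*T)^{1/2}X^*-T^*(I+XX^* )^{1/2}$ and $R_T(X)=(I+XX^* )^{1/2}(I+TT^* )^{1/2}-XT^*$. The metric is $d(T,S)=\tanh^{-1}\|L_T(S)R_S(T)^{-1}\|$ (for $\dim K<\infty$ the inverse exists and $d$ is a metric on $C(H,K)$). In a metric space $M$, a subset $D$ is admissible if it is the intersection of a (nonempty) family of closed balls centered at points of $M$; $\mathcal{A}(M)$ denotes the family of all admissible subsets of $M$. A chain is a family totally ordered by inclusion. *)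

theory Defs
  imports "HOL-Analysis.Analysis"
begin

section \<open>Complex Hilbert spaces\<close>

text \<open>HOL-Analysis provides real inner product spaces only.  A complex Hilbert space is a complete
  real inner product space whose real structure is the one underlying a complex vector space with a
  sesquilinear form \<open>cinner\<close>, linear in the first argument; in particular the norm
  satisfies \<open>norm x ^ 2 = Re (cinner x x)\<close>.\<close>

class complex_hilbert_space = real_inner + complete_space +
  fixes scaleC :: "complex \<Rightarrow> 'a \<Rightarrow> 'a" (infixr "*\<^sub>C" 75)
    and cinner :: "'a \<Rightarrow> 'a \<Rightarrow> complex"
  assumes scaleC_add_right: "c *\<^sub>C (x + y) = c *\<^sub>C x + c *\<^sub>C y"
    and scaleC_add_left: "(c + d) *\<^sub>C x = c *\<^sub>C x + d *\<^sub>C x"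
    and scaleC_scaleC: "c *\<^sub>C (d *\<^sub>C x) = (c * d) *\<^sub>C x"
    and scaleR_scaleC: "scaleR r x = complex_of_real r *\<^sub>C x"
    and cinner_commute: "cinner x y = cnj (cinner y x)"
    and cinner_add_left: "cinner (x + y) z = cinner x z + cinner y z"
    and cinner_scaleC_left: "cinner (c *\<^sub>C x) y = c * cinner x y"
    and inner_eq_Re_cinner: "inner x y = Re (cinner x y)"

instantiation complex :: complex_hilbert_space
begin

definition "scaleC_complex (c :: complex) (x :: complex) = c * x"
definition "cinner_complex (x :: complex) (y :: complex) = x * cnj y"

instance
  by standard
    (simp_all add: scaleC_complex_def cinner_complex_def algebra_simps scaleR_conv_of_real
      inner_complex_def)

end

section \<open>Unbounded operators\<close>

text \<open>A (possibly partially defined) operator is represented by its graph.\<close>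

type_synonym ('h, 'k) operator = "('h \<times> 'k) set"

text \<open>The set \<open>C(H,K)\<close> of closed densely-defined linear operators.\<close>

definition closed_ops :: "('h::complex_hilbert_space, 'k::complex_hilbert_space) operator set" where
  "closed_ops = {T. module.subspace (\<lambda>c (x, y). (c *\<^sub>C x, c *\<^sub>C y)) T
      \<and> single_valued T \<and> closed T \<and> closure (Domain T) = UNIV}"

text \<open>Composition is written in the usual order, the right factor being applied first.  Sum,
  difference and composition have their natural (maximal) domains, and the inverse of an injective
  operator is its \<^const>\<open>converse\<close>.\<close>

abbreviation op_comp :: "('k, 'l) operator \<Rightarrow> ('h, 'k) operator \<Rightarrow> ('h, 'l) operator"
    (infixl "\<circ>\<^sub>o" 70)
  where "S \<circ>\<^sub>o T \<equiv> T O S"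

definition op_add :: "('h, 'k::ab_group_add) operator \<Rightarrow> ('h, 'k) operator \<Rightarrow> ('h, 'k) operator"
    (infixl "+\<^sub>o" 65)
  where "S +\<^sub>o T = {(x, y + z) | x y z. (x, y) \<in> S \<and> (x, z) \<in> T}"

definition op_diff :: "('h, 'k::ab_group_add) operator \<Rightarrow> ('h, 'k) operator \<Rightarrow> ('h, 'k) operator"
    (infixl "-\<^sub>o" 65)
  where "S -\<^sub>o T = {(x, y - z) | x y z. (x, y) \<in> S \<and> (x, z) \<in> T}"

definition adj :: "('h::complex_hilbert_space, 'k::complex_hilbert_space) operator
    \<Rightarrow> ('k, 'h) operator" where
  "adj T = {(y, z). \<forall>(x, w) \<in> T. cinner w y = cinner x z}"

text \<open>For self-adjoint \<open>A\<close> the numbers \<open>cinner (A x) x\<close> are automatically real.\<close>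

definition pos_selfadjoint :: "('h::complex_hilbert_space, 'h) operator \<Rightarrow> bool" where
  "pos_selfadjoint A \<longleftrightarrow>
     A \<in> closed_ops \<and> adj A = A \<and> (\<forall>(x, y) \<in> A. 0 \<le> Re (cinner y x))"

definition op_sqrt :: "('h::complex_hilbert_space, 'h) operator \<Rightarrow> ('h, 'h) operator" where
  "op_sqrt A = (THE B. pos_selfadjoint B \<and> B \<circ>\<^sub>o B = A)"

text \<open>The operator norm; meaningful for everywhere defined bounded operators.\<close>

definition op_norm :: "('h::real_normed_vector, 'k::real_normed_vector) operator \<Rightarrow> real" where
  "op_norm T = Sup {norm y | x y. (x, y) \<in> T \<and> norm x \<le> 1}"

section \<open>The metric\<close>

definition L_op :: "('h::complex_hilbert_space, 'k::complex_hilbert_space) operator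
    \<Rightarrow> ('h, 'k) operator \<Rightarrow> ('k, 'h) operator" where
  "L_op T X = op_sqrt (Id +\<^sub>o adj T \<circ>\<^sub>o T) \<circ>\<^sub>o adj X -\<^sub>o adj T \<circ>\<^sub>o op_sqrt (Id +\<^sub>o X \<circ>\<^sub>o adj X)"

definition R_op :: "('h::complex_hilbert_space, 'k::complex_hilbert_space) operator
    \<Rightarrow> ('h, 'k) operator \<Rightarrow> ('k, 'k) operator" where
  "R_op T X = op_sqrt (Id +\<^sub>o X \<circ>\<^sub>o adj X) \<circ>\<^sub>o op_sqrt (Id +\<^sub>o T \<circ>\<^sub>o adj T) -\<^sub>o X \<circ>\<^sub>o adj T"

text \<open>This is a metric on \<^const>\<open>closed_ops\<close> when the codomain \<open>K\<close> is finite-dimensional.\<close>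

definition op_dist :: "('h::complex_hilbert_space, 'k::complex_hilbert_space) operator
    \<Rightarrow> ('h, 'k) operator \<Rightarrow> real" where
  "op_dist T S = artanh (op_norm (L_op T S \<circ>\<^sub>o (R_op S T)\<inverse>))"

section \<open>Admissible sets\<close>

definition admissible_sets :: "'a set \<Rightarrow> ('a \<Rightarrow> 'a \<Rightarrow> real) \<Rightarrow> 'a set set" where
  "admissible_sets M d =
     {\<Inter>\<B> | \<B>. \<B> \<noteq> {} \<and> \<B> \<subseteq> {{y \<in> M. d x y \<le> r} | x r. x \<in> M \<and> 0 \<le> r}}"

text \<open>Only nonempty chains are considered, the empty one having the whole space as its
  intersection by convention.\<close>

definition compact_family :: "'a set set \<Rightarrow> bool" where
  "compact_family \<A> \<longleftrightarrow> (\<forall>\<C> \<in> chains (\<A> - {{}}). \<C> \<noteq> {} \<longrightarrow> \<Inter>\<C> \<noteq> {})"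

end

theory Submission
  imports Defs
begin

text \<open>As \<open>K\<close> is finite-dimensional, every \<open>S\<close> in \<open>C(H,K)\<close> is bounded and is determined by
  the strict contraction \<open>B = S\<^sup>* (I + SS\<^sup>*)\<^bsup>-1/2\<^esup>\<close> from \<open>K\<close> to \<open>H\<close>.  In this coordinate
  \<open>d(T,S) \<le> r\<close> means \<open>\<parallel>Bx\<parallel>\<^sup>2 + (1 - tanh\<^sup>2 r) \<parallel>(I + TT\<^sup>*)\<^bsup>1/2\<^esup> x - TBx\<parallel>\<^sup>2 \<le> \<parallel>x\<parallel>\<^sup>2\<close>
  for all \<open>x\<close>, a condition that is closed and convex in \<open>B\<close> and that forces \<open>B\<close> to be a strict
  contraction.  Admissible sets thus become bounded closed convex sets in the Hilbert space of
  operators from \<open>K\<close> to \<open>H\<close> with the Hilbert-Schmidt norm, where descending chains of nonempty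
  sets of this kind have nonempty intersection.\<close>

section \<open>Complex scalars\<close>

text \<open>The ball inequality rests on one identity. For \<open>P\<close>, \<open>Q\<close> the
  roots of I + T'T and I + TT', with T' the adjoint, the block operator sending (x, v) to (Q x - T
  v, P v - T' x) preserves the indefinite form |x|^2 - |v|^2. With x = (I + SS')^(1/2) y and v = B x
  it relates the two operators in the distance, so that bounding a quotient of operators becomes an
  upper bound on the norm of an expression affine in \<open>B\<close>. Convexity comes from there.
  Strictness comes from the same source: tanh r < 1 gives the second summand a positive weight, and
  invertibility of the block operator bounds |x| by a multiple of |Q x - T B x|. So no point of such
  a set lies on the boundary of the operator ball, and a common point of a chain is again the
  coordinate of a closed operator. The operator norm violates the parallelogram law, hence the
  Hilbert-Schmidt norm, which is equivalent to it as K is finite-dimensional. Since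
  \<open>op_sqrt\<close> is a definite description among possibly unbounded operators, roots must be
  shown to exist and to be unique before any distance can be computed.\<close>

instance complex_hilbert_space \<subseteq> banach ..

interpretation scaleC: module "scaleC :: complex \<Rightarrow> 'a::complex_hilbert_space \<Rightarrow> 'a"
proof
  fix x :: 'a
  show "1 *\<^sub>C x = x"
    using scaleR_scaleC[of 1 x] by simp
qed (simp_all add: scaleC_add_right scaleC_add_left scaleC_scaleC)

lemma module_prod_scaleC:
  "module (\<lambda>c (x :: 'a::complex_hilbert_space, y :: 'b::complex_hilbert_space). (c *\<^sub>C x, c *\<^sub>C y))"
  by unfold_locales (auto simp: scaleC_add_right scaleC_add_left)

lemma cinner_scaleC_right: "cinner x (c *\<^sub>C y) = cnj c * cinner x y"
  by (metis cinner_commute cinner_scaleC_left complex_cnj_cnj complex_cnj_mult)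

lemma inner_scaleC: "inner (c *\<^sub>C x) y = inner x (cnj c *\<^sub>C y)"
  by (simp add: inner_eq_Re_cinner cinner_scaleC_left cinner_scaleC_right)

lemma Im_cinner: "Im (cinner x y) = inner x (\<i> *\<^sub>C y)"
  by (simp add: inner_eq_Re_cinner cinner_scaleC_right)

lemma scaleC_scaleR_commute: "c *\<^sub>C (r *\<^sub>R x) = r *\<^sub>R (c *\<^sub>C x)"
  by (simp add: scaleR_scaleC mult.commute)

lemma norm_scaleC: "norm (c *\<^sub>C x) = cmod c * norm x"
proof -
  have "(norm (c *\<^sub>C x))\<^sup>2 = inner x ((cnj c * c) *\<^sub>C x)"
    by (simp add: power2_norm_eq_inner inner_scaleC)
  also have "\<dots> = inner x ((cmod c)\<^sup>2 *\<^sub>R x)"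
    by (metis complex_norm_square mult.commute of_real_power scaleR_scaleC)
  finally have "(norm (c *\<^sub>C x))\<^sup>2 = (cmod c * norm x)\<^sup>2"
    by (simp add: power2_norm_eq_inner power_mult_distrib)
  then show ?thesis
    by (simp add: power2_eq_iff_nonneg)
qed

lemma bounded_linear_scaleC: "bounded_linear ((*\<^sub>C) c)"
  by (rule bounded_linear_intro[where K = "cmod c"])
    (simp_all add: scaleC_add_right scaleC_scaleR_commute norm_scaleC)

section \<open>Bounded operators and their adjoints\<close>

definition bounded_clinear :: "('a::complex_hilbert_space \<Rightarrow> 'b::complex_hilbert_space) \<Rightarrow> bool" where
  "bounded_clinear f \<longleftrightarrow> bounded_linear f \<and> (\<forall>c x. f (c *\<^sub>C x) = c *\<^sub>C f x)"

lemma bounded_clinear_imp_bounded_linear: "bounded_clinear f \<Longrightarrow> bounded_linear f"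
  by (simp add: bounded_clinear_def)

lemma bounded_clinear_scaleC: "bounded_clinear f \<Longrightarrow> f (c *\<^sub>C x) = c *\<^sub>C f x"
  by (simp add: bounded_clinear_def)

lemma bounded_clinear_ident: "bounded_clinear (\<lambda>x. x)"
  by (simp add: bounded_clinear_def)

lemma bounded_clinear_add:
  "bounded_clinear f \<Longrightarrow> bounded_clinear g \<Longrightarrow> bounded_clinear (\<lambda>x. f x + g x)"
  by (simp add: bounded_clinear_def bounded_linear_add scaleC_add_right)

lemma bounded_clinear_diff:
  "bounded_clinear f \<Longrightarrow> bounded_clinear g \<Longrightarrow> bounded_clinear (\<lambda>x. f x - g x)"
  by (simp add: bounded_clinear_def bounded_linear_sub scaleC.scale_right_diff_distrib)

lemma bounded_clinear_scaleR:
  "bounded_clinear f \<Longrightarrow> bounded_clinear (\<lambda>x. r *\<^sub>R f x)"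
  by (simp add: bounded_clinear_def bounded_linear_scaleR_right[THEN bounded_linear_compose]
      scaleC_scaleR_commute)

lemma bounded_clinear_compose:
  "bounded_clinear f \<Longrightarrow> bounded_clinear g \<Longrightarrow> bounded_clinear (\<lambda>x. f (g x))"
  by (simp add: bounded_clinear_def bounded_linear_compose)

lemmas bounded_clinear_intros = bounded_clinear_ident bounded_clinear_add bounded_clinear_diff
  bounded_clinear_scaleR

text \<open>The real inner product suffices here: for complex linear maps the adjunction identity for
  \<^const>\<open>inner\<close> implies the one for \<^const>\<open>cinner\<close>.\<close>

definition adjoint_pair :: "('a::complex_hilbert_space \<Rightarrow> 'b::complex_hilbert_space) \<Rightarrow>
    ('b \<Rightarrow> 'a) \<Rightarrow> bool" where
  "adjoint_pair f g \<longleftrightarrow>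
    bounded_clinear f \<and> bounded_clinear g \<and> (\<forall>x y. inner (f x) y = inner x (g y))"

lemma adjoint_pairD:
  assumes "adjoint_pair f g"
  shows "bounded_clinear f" "bounded_clinear g" "inner (f x) y = inner x (g y)"
  using assms by (auto simp: adjoint_pair_def)

lemma adjoint_pair_commute: "adjoint_pair f g \<Longrightarrow> adjoint_pair g f"
  by (simp add: adjoint_pair_def) (metis inner_commute)

lemma adjoint_pair_ident: "adjoint_pair (\<lambda>x. x) (\<lambda>x. x)"
  by (simp add: adjoint_pair_def bounded_clinear_intros)

lemma adjoint_pair_add:
  "adjoint_pair f f' \<Longrightarrow> adjoint_pair g g' \<Longrightarrow> adjoint_pair (\<lambda>x. f x + g x) (\<lambda>x. f' x + g' x)"
  by (simp add: adjoint_pair_def bounded_clinear_intros inner_add)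

lemma adjoint_pair_diff:
  "adjoint_pair f f' \<Longrightarrow> adjoint_pair g g' \<Longrightarrow> adjoint_pair (\<lambda>x. f x - g x) (\<lambda>x. f' x - g' x)"
  by (simp add: adjoint_pair_def bounded_clinear_intros inner_diff)

lemma adjoint_pair_scaleR:
  "adjoint_pair f f' \<Longrightarrow> adjoint_pair (\<lambda>x. r *\<^sub>R f x) (\<lambda>x. r *\<^sub>R f' x)"
  by (simp add: adjoint_pair_def bounded_clinear_intros)

lemma adjoint_pair_compose:
  "adjoint_pair f f' \<Longrightarrow> adjoint_pair g g' \<Longrightarrow> adjoint_pair (\<lambda>x. f (g x)) (\<lambda>x. g' (f' x))"
  by (simp add: adjoint_pair_def bounded_clinear_compose)

lemmas adjoint_pair_intros = adjoint_pair_ident adjoint_pair_add adjoint_pair_diff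
  adjoint_pair_scaleR

section \<open>Positive definite operators and square roots\<close>

text \<open>H may be infinite-dimensional, so a uniform lower bound is required instead of strict
  positivity: it makes I - \<mu> A a strict contraction for small \<mu>.\<close>

definition posdef :: "('a::complex_hilbert_space \<Rightarrow> 'a) \<Rightarrow> bool" where
  "posdef A \<longleftrightarrow> adjoint_pair A A \<and> (\<exists>c>0. \<forall>x. c * (norm x)\<^sup>2 \<le> inner (A x) x)"

lemma posdef_adjoint: "posdef A \<Longrightarrow> adjoint_pair A A"
  by (simp add: posdef_def)

lemma posdef_inner_nonneg: "posdef A \<Longrightarrow> 0 \<le> inner (A x) x"
  unfolding posdef_def by (meson less_imp_le mult_nonneg_nonneg order_trans zero_le_power2)

lemma posdef_inj:
  assumes "posdef A" shows "inj A"
proof -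
  have lin: "linear A"
    using adjoint_pairD(1)[OF posdef_adjoint[OF assms]]
    by (simp add: bounded_clinear_def bounded_linear.linear)
  obtain c where "c > 0" "\<And>x. c * (norm x)\<^sup>2 \<le> inner (A x) x"
    using assms by (auto simp: posdef_def)
  then have "x = 0" if "A x = 0" for x
    using that mult_pos_pos[of c "(norm x)\<^sup>2"]
    by (metis inner_zero_left linorder_not_less norm_eq_zero zero_less_power2)
  then show ?thesis
    by (simp add: linear_injective_0[OF lin])
qed

text \<open>Expanding the square bounds |x - \<mu> A x|^2 by (1 - 2 \<mu> c + \<mu>^2 N^2) |x|^2 for
  any bound N of \<open>A\<close>. Existence and uniqueness of roots both start from this.\<close>

lemma posdef_contraction:
  assumes "posdef A"
  obtains \<mu> r where "0 < \<mu>" "0 \<le> r" "r < 1" "\<And>x. norm (x - \<mu> *\<^sub>R A x) \<le> r * norm x"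
proof -
  obtain c where c: "c > 0" "\<And>x. c * (norm x)\<^sup>2 \<le> inner (A x) x"
    using assms by (auto simp: posdef_def)
  have "bounded_linear A"
    using adjoint_pairD(1)[OF posdef_adjoint[OF assms]] by (simp add: bounded_clinear_def)
  then obtain M where M: "M > 0" "\<And>x. norm (A x) \<le> norm x * M"
    using bounded_linear.pos_bounded by blast
  \<comment> \<open>Adding c forces c \<le> N, so that 1 - c^2 / N^2 is nonnegative, even on the
    zero space.\<close>
  define N where "N = M + c"
  have N: "N > 0" "c \<le> N" "M \<le> N"
    using M(1) c(1) by (simp_all add: N_def)
  \<comment> \<open>The minimiser of 1 - 2 \<mu> c + \<mu>^2 N^2; the minimum is 1 - c^2 /
    N^2.\<close>
  define \<mu> where "\<mu> = c / N\<^sup>2"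
  have \<mu>: "\<mu> > 0"
    using c N by (simp add: \<mu>_def)
  define r where "r = sqrt (1 - c\<^sup>2 / N\<^sup>2)"
  have le1: "c\<^sup>2 / N\<^sup>2 \<le> 1"
    using N c by (simp add: power_mono)
  have pos: "0 < c\<^sup>2 / N\<^sup>2"
    using N c by simp
  have "norm (x - \<mu> *\<^sub>R A x) \<le> r * norm x" for x
  proof (rule power2_le_imp_le)
    have "norm (A x) \<le> N * norm x"
      using M(2)[of x] mult_right_mono[OF N(3) norm_ge_zero[of x]] by (simp add: mult.commute)
    then have "(norm (A x))\<^sup>2 \<le> N\<^sup>2 * (norm x)\<^sup>2"
      by (metis norm_ge_zero power_mono power_mult_distrib)
    then have 1: "\<mu>\<^sup>2 * (norm (A x))\<^sup>2 \<le> \<mu>\<^sup>2 * (N\<^sup>2 * (norm x)\<^sup>2)"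
      by (simp add: mult_left_mono)
    have 2: "\<mu> * (c * (norm x)\<^sup>2) \<le> \<mu> * inner (A x) x"
      using c(2)[of x] \<mu> by simp
    have "(norm (x - \<mu> *\<^sub>R A x))\<^sup>2 = (norm x)\<^sup>2 - 2 * (\<mu> * inner (A x) x) + \<mu>\<^sup>2 * (norm (A x))\<^sup>2"
      unfolding power2_norm_eq_inner
      by (simp add: inner_diff inner_commute power2_eq_square algebra_simps)
    also have "\<dots> \<le> (norm x)\<^sup>2 - 2 * (\<mu> * (c * (norm x)\<^sup>2)) + \<mu>\<^sup>2 * (N\<^sup>2 * (norm x)\<^sup>2)"
      using 1 2 by linarith
    also have "\<dots> = (1 - c\<^sup>2 / N\<^sup>2) * (norm x)\<^sup>2"
      using N by (simp add: \<mu>_def field_simps power2_eq_square)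
    finally show "(norm (x - \<mu> *\<^sub>R A x))\<^sup>2 \<le> (r * norm x)\<^sup>2"
      using le1 by (simp add: r_def power_mult_distrib)
    show "0 \<le> r * norm x"
      using le1 by (simp add: r_def)
  qed
  moreover have "0 \<le> r" "r < 1"
    using le1 pos by (simp_all add: r_def)
  ultimately show ?thesis
    using that \<mu> by blast
qed

lemma closed_bounded_clinear: "closed {Y :: 'a::complex_hilbert_space \<Rightarrow>\<^sub>L 'b::complex_hilbert_space.
    bounded_clinear (blinfun_apply Y)}"
proof -
  have "{Y :: 'a \<Rightarrow>\<^sub>L 'b. bounded_clinear (blinfun_apply Y)} =
      (\<Inter>c x. {Y. blinfun_apply Y (c *\<^sub>C x) = c *\<^sub>C blinfun_apply Y x})"
    by (auto simp: bounded_clinear_def blinfun.bounded_linear_right)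
  also have "closed \<dots>"
    by (intro closed_INT ballI closed_Collect_eq
        bounded_linear.continuous_on[OF bounded_linear_scaleC] continuous_intros)
  finally show ?thesis .
qed

text \<open>With \<open>\<parallel>I - \<mu>A\<parallel> < 1\<close>, a fixed point \<open>Y\<close> of the contraction
  \<open>Y \<mapsto> (I - \<mu>A + Y\<^sup>2) / 2\<close> satisfies \<open>(I - Y)\<^sup>2 = \<mu>A\<close>.\<close>

lemma posdef_sqrt_exists:
  fixes A :: "'a::complex_hilbert_space \<Rightarrow> 'a"
  assumes "posdef A"
  obtains Q where "posdef Q" "\<And>x. Q (Q x) = A x"
proof -
  obtain \<mu> r where \<mu>: "0 < \<mu>" and r: "0 \<le> r" "r < 1"
    and contr: "\<And>x. norm (x - \<mu> *\<^sub>R A x) \<le> r * norm x"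
    using posdef_contraction[OF assms] by metis
  have A: "adjoint_pair A A"
    using assms by (rule posdef_adjoint)
  have adjZ: "adjoint_pair (\<lambda>x. x - \<mu> *\<^sub>R A x) (\<lambda>x. x - \<mu> *\<^sub>R A x)"
    by (intro adjoint_pair_intros A)
  define Z where "Z = Blinfun (\<lambda>x. x - \<mu> *\<^sub>R A x)"
  have Z: "blinfun_apply Z = (\<lambda>x. x - \<mu> *\<^sub>R A x)"
    unfolding Z_def
    by (rule bounded_linear_Blinfun_apply)
       (use adjoint_pairD(1)[OF adjZ] in \<open>simp add: bounded_clinear_def\<close>)
  have normZ: "norm Z \<le> r"
    by (rule norm_blinfun_bound) (use r contr in \<open>simp_all add: Z\<close>)
  \<comment> \<open>Self-adjointness and complex linearity are closed conditions; built into the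
    domain, they pass to the fixed point.\<close>
  define S :: "('a \<Rightarrow>\<^sub>L 'a) set" where
    "S = cball 0 r \<inter> {Y. bounded_clinear (blinfun_apply Y)} \<inter>
      (\<Inter>x y. {Y. inner (blinfun_apply Y x) y = inner x (blinfun_apply Y y)})"
  have S_iff: "Y \<in> S \<longleftrightarrow> norm Y \<le> r \<and> adjoint_pair (blinfun_apply Y) (blinfun_apply Y)" for Y
    by (auto simp: S_def adjoint_pair_def)
  define F where "F Y = (1/2) *\<^sub>R (Z + (Y o\<^sub>L Y))" for Y
  have F_apply: "blinfun_apply (F Y) = (\<lambda>x. (1/2) *\<^sub>R ((x - \<mu> *\<^sub>R A x) + blinfun_apply Y (blinfun_apply Y x)))" for Y
    by (simp add: F_def Z fun_eq_iff blinfun.bilinear_simps)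
  have "\<exists>!Y. Y \<in> S \<and> F Y = Y"
  proof (rule Banach_fix)
    have "closed (\<Inter>x y. {Y :: 'a \<Rightarrow>\<^sub>L 'a. inner (blinfun_apply Y x) y = inner x (blinfun_apply Y y)})"
      by (intro closed_INT ballI closed_Collect_eq continuous_intros)
    then have "closed S"
      unfolding S_def by (intro closed_Int closed_cball closed_bounded_clinear)
    then show "complete S"
      by (simp add: complete_eq_closed)
    have "adjoint_pair (\<lambda>x::'a. 0) (\<lambda>x. 0::'a)"
      by (simp add: adjoint_pair_def bounded_clinear_def)
    then have "0 \<in> S"
      using r by (simp add: S_iff zero_blinfun.rep_eq[abs_def])
    then show "S \<noteq> {}" by blast
    show "0 \<le> r" "r < 1" by (fact r)+
    show "F ` S \<subseteq> S"
    proof clarify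
      fix Y assume Y: "Y \<in> S"
      have "norm (Y o\<^sub>L Y) \<le> norm Y * norm Y"
        by (rule norm_blinfun_compose)
      also have "\<dots> \<le> r * 1"
        using Y r by (intro mult_mono) (auto simp: S_iff)
      finally have "norm (Z + (Y o\<^sub>L Y)) \<le> r + r"
        using normZ norm_triangle_ineq[of Z "Y o\<^sub>L Y"] by linarith
      then have "norm (F Y) \<le> r"
        by (simp add: F_def)
      moreover have "adjoint_pair (blinfun_apply (F Y)) (blinfun_apply (F Y))"
        unfolding F_apply using Y
        by (intro adjoint_pair_intros adjoint_pair_compose[of Y Y Y Y] A) (simp_all add: S_iff)
      ultimately show "F Y \<in> S"
        by (simp add: S_iff)
    qed
    show "dist (F X) (F Y) \<le> r * dist X Y" if "X \<in> S" "Y \<in> S" for X Y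
    proof -
      \<comment> \<open>X^2 - Y^2 for operators that need not commute, split so that each term
        contains a factor of norm at most r; the 1/2 in \<open>F\<close> makes up for the two
        terms.\<close>
      have eq: "F X - F Y = (1/2) *\<^sub>R ((X o\<^sub>L (X - Y)) + ((X - Y) o\<^sub>L Y))"
        by (rule blinfun_eqI) (simp add: F_def blinfun.bilinear_simps algebra_simps)
      have "norm (X o\<^sub>L (X - Y)) \<le> r * norm (X - Y)"
        using that by (intro order_trans[OF norm_blinfun_compose] mult_right_mono) (auto simp: S_iff)
      moreover have "norm ((X - Y) o\<^sub>L Y) \<le> norm (X - Y) * r"
        using that by (intro order_trans[OF norm_blinfun_compose] mult_left_mono) (auto simp: S_iff)
      ultimately have "norm ((X o\<^sub>L (X - Y)) + ((X - Y) o\<^sub>L Y)) \<le> 2 * (r * norm (X - Y))"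
        using norm_triangle_ineq[of "X o\<^sub>L (X - Y)" "(X - Y) o\<^sub>L Y"] by (simp add: mult.commute)
      then show ?thesis
        by (simp add: dist_norm eq)
    qed
  qed
  then obtain Y where Y: "Y \<in> S" "F Y = Y" by blast
  have YY: "blinfun_apply Y (blinfun_apply Y x) = 2 *\<^sub>R blinfun_apply Y x - x + \<mu> *\<^sub>R A x" for x
  proof -
    have "blinfun_apply Y x = (1/2) *\<^sub>R ((x - \<mu> *\<^sub>R A x) + blinfun_apply Y (blinfun_apply Y x))"
      using fun_cong[OF F_apply[of Y], of x] unfolding Y(2) .
    then have "2 *\<^sub>R blinfun_apply Y x = (x - \<mu> *\<^sub>R A x) + blinfun_apply Y (blinfun_apply Y x)"
      by (metis (no_types) scaleR_half_double scaleR_right_distrib scaleR_2)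
    then show ?thesis
      by (simp add: algebra_simps)
  qed
  define s where "s = 1 / sqrt \<mu>"
  have s: "s > 0" "s * s * \<mu> = 1"
    using \<mu> by (simp_all add: s_def)
  define Q where "Q x = s *\<^sub>R (x - blinfun_apply Y x)" for x
  have adjY: "adjoint_pair (blinfun_apply Y) (blinfun_apply Y)" and normY: "norm Y \<le> r"
    using Y(1) by (simp_all add: S_iff)
  have "adjoint_pair Q Q"
    unfolding Q_def[abs_def] by (intro adjoint_pair_intros adjY)
  moreover have "s * (1 - r) * (norm x)\<^sup>2 \<le> inner (Q x) x" for x
  proof -
    have "inner (blinfun_apply Y x) x \<le> norm (blinfun_apply Y x) * norm x"
      by (rule norm_cauchy_schwarz)
    also have "\<dots> \<le> (r * norm x) * norm x"
      by (intro mult_right_mono order_trans[OF norm_blinfun] normY) simp_all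
    finally have "(1 - r) * (norm x)\<^sup>2 \<le> inner (x - blinfun_apply Y x) x"
      by (simp add: inner_diff_left power2_norm_eq_inner[symmetric] power2_eq_square algebra_simps)
    then show ?thesis
      using s(1) by (simp add: Q_def)
  qed
  ultimately have "posdef Q"
    unfolding posdef_def using s(1) r(2) by (metis diff_gt_0_iff_gt mult_pos_pos)
  moreover have "Q (Q x) = A x" for x
  proof -
    have "Q (Q x) = (s * s) *\<^sub>R (x - 2 *\<^sub>R blinfun_apply Y x + blinfun_apply Y (blinfun_apply Y x))"
      by (simp add: Q_def blinfun.bilinear_simps algebra_simps scaleR_2)
    also have "\<dots> = A x"
      by (simp add: YY s(2))
    finally show ?thesis .
  qed
  ultimately show ?thesis
    using that by blast
qed

text \<open>For large \<open>\<nu>\<close> one has \<open>(B + \<nu>) D = D (\<nu> - P)\<close>, where \<open>B + \<nu>\<close> expands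
  by at least \<open>\<nu>\<close> and \<open>\<nu> - P\<close> by strictly less.\<close>

lemma posdef_sylvester:
  assumes P: "posdef P" and D: "bounded_linear D"
    and B: "\<And>x. 0 \<le> inner (B x) x"
    and eq: "\<And>x. B (D x) = - D (P x)"
  shows "D x = 0"
proof -
  obtain \<mu> r where \<mu>: "0 < \<mu>" and r: "0 \<le> r" "r < 1"
    and contr: "\<And>x. norm (x - \<mu> *\<^sub>R P x) \<le> r * norm x"
    using posdef_contraction[OF P] by metis
  interpret D: bounded_linear D by (rule D)
  have expand: "norm y \<le> norm (y + \<mu> *\<^sub>R B y)" for y
  proof (rule power2_le_imp_le)
    have "0 \<le> \<mu> * inner (B y) y" "0 \<le> \<mu> * (\<mu> * inner (B y) (B y))"
      using \<mu> B by simp_all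
    then show "(norm y)\<^sup>2 \<le> (norm (y + \<mu> *\<^sub>R B y))\<^sup>2"
      unfolding power2_norm_eq_inner by (simp add: inner_add inner_commute add_increasing2)
  qed simp
  have "norm (D x) \<le> onorm D * r * norm x" for x
  proof -
    \<comment> \<open>By \<open>eq\<close>, \<open>D\<close> maps x - \<mu> P x to D x + \<mu> B (D
      x).\<close>
    have "norm (D x) \<le> norm (D (x - \<mu> *\<^sub>R P x))"
      using expand[of "D x"] by (simp add: D.diff D.scaleR eq)
    also have "\<dots> \<le> onorm D * norm (x - \<mu> *\<^sub>R P x)"
      by (rule onorm[OF D])
    also have "\<dots> \<le> onorm D * (r * norm x)"
      by (intro mult_left_mono contr onorm_pos_le D)
    finally show ?thesis by (simp add: mult.assoc)
  qed
  then have "onorm D \<le> onorm D * r"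
    by (intro onorm_bound mult_nonneg_nonneg onorm_pos_le D r(1))
  then have "onorm D * (1 - r) \<le> 0"
    by (simp add: algebra_simps)
  then have "onorm D = 0"
    using r(2) onorm_pos_le[OF D] by (auto simp: mult_le_0_iff)
  then show ?thesis
    by (simp add: onorm_eq_0[OF D])
qed

section \<open>Convex sets in Hilbert spaces\<close>

text \<open>The parallelogram law makes the subsets of almost minimal \<open>N\<close> small, so that no weak
  topology is needed.\<close>

lemma closed_convex_chain_Inter:
  fixes N :: "'v::banach \<Rightarrow> real"
  assumes cont: "continuous_on UNIV N"
    and parallelogram: "\<And>x y. N (x - y) = 2 * N x + 2 * N y - 4 * N ((1/2) *\<^sub>R (x + y))"
    and norm_le: "\<And>x. (norm x)\<^sup>2 \<le> K * N x"
    and N_nonneg: "\<And>x. 0 \<le> N x" and "0 < K"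
    and chain: "\<And>A B. A \<in> \<C> \<Longrightarrow> B \<in> \<C> \<Longrightarrow> A \<subseteq> B \<or> B \<subseteq> A"
    and clo: "\<And>A. A \<in> \<C> \<Longrightarrow> closed A" and conv: "\<And>A. A \<in> \<C> \<Longrightarrow> convex A"
    and nonempty: "\<And>A. A \<in> \<C> \<Longrightarrow> A \<noteq> {}" "\<C> \<noteq> {}"
    and bdd: "\<And>A x. A \<in> \<C> \<Longrightarrow> x \<in> A \<Longrightarrow> N x \<le> M"
  shows "\<Inter>\<C> \<noteq> {}"
proof -
  define m where "m A = Inf (N ` A)" for A
  have bb: "bdd_below (N ` A)" for A
    using N_nonneg by (intro bdd_belowI2[of _ 0])
  have m_le: "m A \<le> N x" if "x \<in> A" for A x
    unfolding m_def using bb that by (auto intro: cInf_lower)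
  \<comment> \<open>The infima grow as the sets of the chain shrink; \<open>M\<close> keeps their
    supremum finite.\<close>
  define s where "s = Sup (m ` \<C>)"
  have ba: "bdd_above (m ` \<C>)"
  proof (rule bdd_aboveI2)
    fix A assume A: "A \<in> \<C>"
    then obtain x where "x \<in> A" using nonempty(1) by blast
    then show "m A \<le> M" using m_le[of x A] bdd[OF A] by (meson order_trans)
  qed
  have m_le_s: "m A \<le> s" if "A \<in> \<C>" for A
    unfolding s_def using ba that by (auto intro: cSup_upper)
  have ne: "\<exists>x\<in>A. N x \<le> s + \<epsilon>" if "A \<in> \<C>" "\<epsilon> > 0" for A \<epsilon>
  proof -
    have "Inf (N ` A) < s + \<epsilon>"
      using m_le_s[OF that(1)] that(2) by (simp add: m_def)
    then show ?thesis
      using cInf_lessD[of "N ` A" "s + \<epsilon>"] nonempty(1)[OF that(1)] by force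
  qed
  define \<D> where "\<D> = {A \<inter> {x. N x \<le> s + \<epsilon>} | A \<epsilon>. A \<in> \<C> \<and> \<epsilon> > 0}"
  have "\<Inter>\<D> \<noteq> {}"
  proof -
    have clo\<D>: "closed D" if "D \<in> \<D>" for D
      using that clo unfolding \<D>_def
      by (auto intro!: closed_Int closed_Collect_le cont continuous_on_const)
    have small: "\<exists>D a. D \<in> \<D> \<and> D \<subseteq> cball a e" if "e > 0" for e
    proof -
      \<comment> \<open>N a and N x at most s + \<epsilon>, and at least s - \<epsilon> at the
        midpoint, give N (a - x) \<le> 8 \<epsilon>; \<open>norm_le\<close> then costs a factor
        K.\<close>
      define \<epsilon> where "\<epsilon> = e\<^sup>2 / (8 * K)"
      have \<epsilon>: "\<epsilon> > 0" "K * (8 * \<epsilon>) = e\<^sup>2"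
        using that \<open>0 < K\<close> by (simp_all add: \<epsilon>_def)
      obtain A where A: "A \<in> \<C>" "s - \<epsilon> < m A"
        using less_cSup_iff[of "m ` \<C>" "s - \<epsilon>"] ba nonempty(2) \<epsilon>(1) by (auto simp: s_def)
      obtain a where a: "a \<in> A" "N a \<le> s + \<epsilon>"
        using ne[OF A(1) \<epsilon>(1)] by blast
      have "x \<in> cball a e" if x: "x \<in> A" "N x \<le> s + \<epsilon>" for x
      proof -
        have "(1/2) *\<^sub>R (a + x) \<in> A"
          using convexD[OF conv[OF A(1)] a(1) x(1), of "1/2" "1/2"]
          by (simp add: scaleR_right_distrib)
        then have "s - \<epsilon> \<le> N ((1/2) *\<^sub>R (a + x))"
          using m_le A(2) by (meson less_imp_le order_trans)
        then have "N (a - x) \<le> 8 * \<epsilon>"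
          unfolding parallelogram using a(2) x(2) by linarith
        then have "(norm (a - x))\<^sup>2 \<le> e\<^sup>2"
          using norm_le[of "a - x"] \<open>0 < K\<close> \<epsilon>(2)
          by (metis mult_left_mono less_imp_le order_trans)
        then show ?thesis
          using \<open>e > 0\<close> by (simp add: dist_norm power2_le_iff_abs_le)
      qed
      moreover have "A \<inter> {x. N x \<le> s + \<epsilon>} \<in> \<D>"
        using A(1) \<epsilon>(1) by (auto simp: \<D>_def)
      ultimately show ?thesis by blast
    qed
    have fip: "\<Inter>\<F> \<noteq> {}" if "finite \<F>" "\<F> \<subseteq> \<D>" for \<F>
    proof -
      have "\<exists>A\<in>\<C>. \<exists>\<epsilon>>0. A \<inter> {x. N x \<le> s + \<epsilon>} \<subseteq> \<Inter>\<F>"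
        using that
      proof (induction \<F> rule: finite_induct)
        case empty
        then show ?case using nonempty(2) zero_less_one by blast
      next
        case (insert D \<F>)
        then obtain A \<epsilon> where A: "A \<in> \<C>" "\<epsilon> > 0" "A \<inter> {x. N x \<le> s + \<epsilon>} \<subseteq> \<Inter>\<F>"
          by auto
        obtain A' \<epsilon>' where A': "A' \<in> \<C>" "\<epsilon>' > 0" "D = A' \<inter> {x. N x \<le> s + \<epsilon>'}"
          using insert.prems by (auto simp: \<D>_def)
        \<comment> \<open>In a chain the intersection is the smaller of the two sets.\<close>
        have "A \<inter> A' \<in> \<C>"
          using chain[OF A(1) A'(1)] A(1) A'(1) by (metis inf.absorb_iff2 inf.orderE)
        moreover have "A \<inter> A' \<inter> {x. N x \<le> s + min \<epsilon> \<epsilon>'} \<subseteq> \<Inter>(insert D \<F>)"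
          using A(3) A'(3) by force
        moreover have "min \<epsilon> \<epsilon>' > 0" using A(2) A'(2) by simp
        ultimately show ?case by blast
      qed
      then show ?thesis using ne by fastforce
    qed
    \<comment> \<open>Cantor's intersection theorem: in a complete space, closed sets with the
      finite intersection property and arbitrarily small members share a point.\<close>
    have "Met_TC.mcomplete TYPE('v)"
      by (simp add: complete_UNIV)
    then show ?thesis
      unfolding Met_TC.mcomplete_fip using clo\<D> small fip by simp
  qed
  moreover have "\<Inter>\<D> \<subseteq> \<Inter>\<C>"
  proof (rule Inter_greatest)
    fix A assume "A \<in> \<C>"
    then have "A \<inter> {x. N x \<le> s + 1} \<in> \<D>"
      by (auto simp: \<D>_def intro!: exI[of _ A] exI[of _ 1])
    then show "\<Inter>\<D> \<subseteq> A" by blast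
  qed
  ultimately show ?thesis by blast
qed

text \<open>The point of \<open>G\<close> nearest to z is obtained as a common point of a chain of
  convex sets, with the squared norm as \<open>N\<close>.\<close>

lemma orthogonal_projection_exists:
  fixes G :: "'v::{real_inner, banach} set"
  assumes "subspace G" "closed G"
  obtains p where "p \<in> G" "\<And>g. g \<in> G \<Longrightarrow> inner (z - p) g = 0"
proof -
  have "0 \<in> G" using assms(1) by (rule subspace_0)
  define d where "d = infdist z G"
  \<comment> \<open>Radii strictly above the distance make the sets nonempty; the cap d + 1 bounds
    them uniformly.\<close>
  define \<C> where "\<C> = (\<lambda>\<rho>. G \<inter> cball z \<rho>) ` {d<..d+1}"
  have "\<Inter>\<C> \<noteq> {}"
  proof (rule closed_convex_chain_Inter[where N = "\<lambda>x. (norm x)\<^sup>2" and K = 1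
        and M = "(norm z + (d + 1))\<^sup>2"])
    show "continuous_on UNIV (\<lambda>x::'v. (norm x)\<^sup>2)"
      by (intro continuous_intros)
    show "(norm (x - y))\<^sup>2 = 2 * (norm x)\<^sup>2 + 2 * (norm y)\<^sup>2 - 4 * (norm ((1/2) *\<^sub>R (x + y)))\<^sup>2"
      for x y :: 'v
      unfolding power2_norm_eq_inner by (simp add: inner_simps inner_commute field_simps)
    show "A \<subseteq> B \<or> B \<subseteq> A" if AB: "A \<in> \<C>" "B \<in> \<C>" for A B
    proof -
      obtain a b where "A = G \<inter> cball z a" "B = G \<inter> cball z b"
        using AB unfolding \<C>_def by blast
      then show ?thesis
        using subset_cball[of a b z] subset_cball[of b a z] linear[of a b] by blast
    qed
    show "closed A" "convex A" if "A \<in> \<C>" for A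
      using that assms by (auto simp: \<C>_def closed_Int convex_Int subspace_imp_convex)
    show "A \<noteq> {}" if A: "A \<in> \<C>" for A
    proof -
      obtain \<rho> where \<rho>: "A = G \<inter> cball z \<rho>" "d < \<rho>" using A by (auto simp: \<C>_def)
      have "Inf (dist z ` G) < \<rho>"
        using \<rho>(2) \<open>0 \<in> G\<close> by (auto simp: d_def infdist_def split: if_splits)
      then obtain g where "g \<in> G" "dist z g < \<rho>"
        using cInf_lessD[of "dist z ` G" \<rho>] \<open>0 \<in> G\<close> by auto
      then show ?thesis using \<rho>(1) by auto
    qed
    show "(norm x)\<^sup>2 \<le> (norm z + (d + 1))\<^sup>2" if "A \<in> \<C>" "x \<in> A" for A x
    proof -
      have "norm (z - x) \<le> d + 1" using that by (auto simp: \<C>_def dist_norm)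
      then have "norm x \<le> norm z + (d + 1)"
        using norm_triangle_sub[of x z] by (simp add: norm_minus_commute)
      then show ?thesis by (simp add: power_mono)
    qed
    show "\<C> \<noteq> {}" by (simp add: \<C>_def)
  qed auto
  then obtain p where "p \<in> \<Inter>\<C>" by blast
  then have p: "\<And>\<rho>. d < \<rho> \<Longrightarrow> \<rho> \<le> d + 1 \<Longrightarrow> p \<in> G \<inter> cball z \<rho>"
    unfolding \<C>_def by (auto simp del: mem_cball)
  have "p \<in> G" using p[of "d + 1"] by simp
  have "dist z p \<le> d"
  proof (rule field_le_epsilon)
    fix e :: real assume "e > 0"
    then have "dist z p \<le> d + min e 1" using p[of "d + min e 1"] by simp
    then show "dist z p \<le> d + e" by linarith
  qed
  then have closest: "\<forall>g\<in>G. dist z p \<le> dist z g"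
    unfolding d_def by (meson infdist_le order_trans)
  have "inner (z - p) g = 0" if g: "g \<in> G" for g
  proof -
    have "p + g \<in> G" "p - g \<in> G"
      using assms(1) \<open>p \<in> G\<close> g by (simp_all add: subspace_add subspace_diff)
    \<comment> \<open>The variational inequality at p + g and at p - g gives both signs.\<close>
    then have "inner (z - p) ((p + g) - p) \<le> 0" "inner (z - p) ((p - g) - p) \<le> 0"
      using any_closest_point_dot[OF subspace_imp_convex[OF assms(1)] assms(2) \<open>p \<in> G\<close> _ closest]
      by blast+
    then show ?thesis by (simp add: inner_minus_right)
  qed
  then show ?thesis using that \<open>p \<in> G\<close> by blast
qed

section \<open>Finite dimension\<close>

lemma finite_span_scaleC_imp_scaleR:
  assumes "finite B" "module.span (scaleC :: complex \<Rightarrow> 'k::complex_hilbert_space \<Rightarrow> 'k) B = UNIV"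
  shows "\<exists>B' :: 'k set. finite B' \<and> span B' = UNIV"
proof -
  define V where "V = span (B \<union> (*\<^sub>C) \<i> ` B)"
  have decomp: "c *\<^sub>C x = Re c *\<^sub>R x + Im c *\<^sub>R (\<i> *\<^sub>C x)" for c and x :: 'k
  proof -
    have "c = complex_of_real (Re c) + complex_of_real (Im c) * \<i>"
      by (simp add: complex_eq mult.commute)
    then show ?thesis
      by (metis scaleC_add_left scaleC_scaleC scaleR_scaleC)
  qed
  have ii: "\<i> *\<^sub>C (\<i> *\<^sub>C x) = - x" for x :: 'k
    by (simp add: decomp[of "-1"])
  \<comment> \<open>c x is a real combination of x and i x, so the induction has to carry both
    memberships.\<close>
  have "x \<in> V \<and> \<i> *\<^sub>C x \<in> V" for x
  proof -
    have "x \<in> scaleC.span B" using assms(2) by simp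
    then show ?thesis
    proof (induction rule: scaleC.span_induct)
      case base
      have *: "\<i> *\<^sub>C (c *\<^sub>C x) = Re c *\<^sub>R (\<i> *\<^sub>C x) - Im c *\<^sub>R x" for c and x :: 'k
        by (subst decomp) (simp add: scaleC_add_right scaleC_scaleR_commute ii)
      have "c *\<^sub>C x \<in> V \<and> \<i> *\<^sub>C (c *\<^sub>C x) \<in> V" if "x \<in> V \<and> \<i> *\<^sub>C x \<in> V" for c x
        unfolding * unfolding decomp[of c x] using that
        by (simp add: V_def span_add span_diff span_scale)
      moreover have "x + y \<in> V \<and> \<i> *\<^sub>C (x + y) \<in> V"
        if "x \<in> V \<and> \<i> *\<^sub>C x \<in> V" "y \<in> V \<and> \<i> *\<^sub>C y \<in> V" for x y
        using that by (simp add: V_def scaleC_add_right span_add)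
      moreover have "0 \<in> V \<and> \<i> *\<^sub>C 0 \<in> V"
        by (simp add: V_def span_zero)
      ultimately show ?case
        by (intro scaleC.subspaceI) blast+
    next
      case (step x)
      then show ?case
        by (auto simp: V_def intro: span_base)
    qed
  qed
  then show ?thesis
    using assms(1) unfolding V_def by (intro exI[of _ "B \<union> (*\<^sub>C) \<i> ` B"]) auto
qed

text \<open>Finite dimension is a hypothesis on \<open>'k\<close>, not a type class. A maximal
  independent subset of the spanning set is the basis with which the locale of finite-dimensional
  spaces is entered.\<close>

lemma linear_inj_imp_surj_finite_span:
  fixes f :: "'k::real_vector \<Rightarrow> 'k"
  assumes "\<exists>B :: 'k set. finite B \<and> span B = UNIV" "linear f" "inj f"
  shows "surj f"
proof -
  obtain B :: "'k set" where B: "finite B" "span B = UNIV" using assms(1) by blast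
  obtain C where C: "C \<subseteq> B" "independent C" "B \<subseteq> span C"
    using real_vector.maximal_independent_subset[of B] by blast
  have "span C = UNIV"
    using B(2) C(3) span_mono span_span by (metis top.extremum_unique)
  then interpret fd: finite_dimensional_vector_space "scaleR :: real \<Rightarrow> 'k \<Rightarrow> 'k" C
    using C B by unfold_locales (auto intro: finite_subset simp flip: dependent_raw_def span_raw_def)
  show ?thesis
    using fd.linear_inj_imp_surj assms(2,3) by (simp add: linear_def)
qed

lemma orthonormal_basis_exists:
  assumes "\<exists>B :: 'k::real_inner set. finite B \<and> span B = UNIV"
  obtains E :: "'k::real_inner set" where "finite E" "\<And>e. e \<in> E \<Longrightarrow> norm e = 1"
    "\<And>x. x = (\<Sum>e\<in>E. inner x e *\<^sub>R e)"
proof -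
  obtain B :: "'k set" where B: "finite B" "span B = UNIV" using assms by metis
  obtain C :: "'k set" where C: "finite C" "span C = UNIV" "pairwise orthogonal C"
    using basis_orthogonal[OF B(1)] unfolding B(2) by metis
  \<comment> \<open>An orthogonal spanning set may contain 0, which has to go before
    normalising.\<close>
  define E where "E = (\<lambda>x. x /\<^sub>R norm x) ` (C - {0})"
  have fin: "finite E" using C(1) by (simp add: E_def)
  have norm: "norm e = 1" if "e \<in> E" for e
    using that left_inverse[of "norm _"] unfolding E_def by fastforce
  have orth: "inner e e' = 0" if "e \<in> E" "e' \<in> E" "e \<noteq> e'" for e e'
    using that C(3) by (fastforce simp: E_def pairwise_def orthogonal_def)
  have "C \<subseteq> span E"
  proof
    fix x assume "x \<in> C"
    show "x \<in> span E"
    proof (cases "x = 0")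
      case False
      then have "x /\<^sub>R norm x \<in> E" using \<open>x \<in> C\<close> by (auto simp: E_def)
      then have "norm x *\<^sub>R (x /\<^sub>R norm x) \<in> span E" by (intro span_scale span_base)
      then show ?thesis using False by simp
    qed (simp add: span_zero)
  qed
  then have E: "span E = UNIV"
    using C(2) span_mono span_span by (metis top.extremum_unique)
  have "x = (\<Sum>e\<in>E. inner x e *\<^sub>R e)" for x
  proof -
    have "x \<in> span E" using E by simp
    then show ?thesis
    proof (induction rule: span_induct)
      case base
      show ?case
        unfolding subspace_def
        by (auto simp: inner_add_left scaleR_left_distrib sum.distrib
            simp flip: scaleR_scaleR scaleR_sum_right)
    next
      case (step x)
      have "(\<Sum>e\<in>E. inner x e *\<^sub>R e) = (\<Sum>e\<in>E. if e = x then x else 0)"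
        using norm[OF step] orth[OF step]
        by (intro sum.cong) (auto simp: norm_eq_sqrt_inner)
      then show ?case using fin step by simp
    qed
  qed
  then show ?thesis using that fin norm by blast
qed

lemma norm_linear_le_orthonormal:
  assumes "linear f" "\<And>e. e \<in> E \<Longrightarrow> norm e = 1" "x = (\<Sum>e\<in>E. inner x e *\<^sub>R e)"
  shows "norm (f x) \<le> norm x * (\<Sum>e\<in>E. norm (f e))"
proof -
  have "f x = (\<Sum>e\<in>E. inner x e *\<^sub>R f e)"
    by (subst assms(3)) (simp add: linear_sum[OF assms(1)] linear_scale[OF assms(1)])
  also have "norm \<dots> \<le> (\<Sum>e\<in>E. norm x * norm (f e))"
  proof (rule sum_norm_le)
    fix e assume "e \<in> E"
    then have "\<bar>inner x e\<bar> \<le> norm x"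
      using Cauchy_Schwarz_ineq2[of x e] assms(2) by simp
    then show "norm (inner x e *\<^sub>R f e) \<le> norm x * norm (f e)"
      by (simp add: mult_right_mono)
  qed
  finally show ?thesis by (simp add: sum_distrib_left)
qed

lemma linear_bounded_finite_span:
  fixes f :: "'k::real_inner \<Rightarrow> 'b::real_normed_vector"
  assumes "\<exists>B :: 'k set. finite B \<and> span B = UNIV" "linear f"
  shows "bounded_linear f"
proof -
  obtain E :: "'k set" where E: "finite E" "\<And>e. e \<in> E \<Longrightarrow> norm e = 1"
    "\<And>x. x = (\<Sum>e\<in>E. inner x e *\<^sub>R e)"
    using orthonormal_basis_exists[OF assms(1)] by metis
  have "norm (f x) \<le> norm x * (\<Sum>e\<in>E. norm (f e))" for x
    by (rule norm_linear_le_orthonormal[OF assms(2) E(2,3)])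
  then show ?thesis
    using assms(2) by (intro bounded_linear_intro) (auto simp: linear_add linear_scale)
qed

lemma adjoint_exists_finite_span:
  fixes f :: "'k::complex_hilbert_space \<Rightarrow> 'h::complex_hilbert_space"
  assumes "\<exists>B :: 'k set. finite B \<and> span B = UNIV" "bounded_clinear f"
  obtains g where "adjoint_pair f g"
proof -
  obtain E :: "'k set" where E: "finite E" "\<And>e. e \<in> E \<Longrightarrow> norm e = 1"
    "\<And>x. x = (\<Sum>e\<in>E. inner x e *\<^sub>R e)"
    using orthonormal_basis_exists[OF assms(1)] by metis
  have lin: "linear f"
    using assms(2) by (simp add: bounded_clinear_def bounded_linear.linear)
  define g where "g y = (\<Sum>e\<in>E. inner y (f e) *\<^sub>R e)" for y
  have adj: "inner (f x) y = inner x (g y)" for x y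
  proof -
    have "f x = (\<Sum>e\<in>E. inner x e *\<^sub>R f e)"
      by (subst E(3)) (simp add: linear_sum[OF lin] linear_scale[OF lin])
    then show ?thesis
      by (simp add: g_def inner_sum_left inner_sum_right inner_commute mult.commute)
  qed
  \<comment> \<open>\<open>E\<close> is orthonormal for the real inner product only, so complex
    linearity is not read off the formula for \<open>g\<close> but inherited from \<open>f\<close>
    through the adjunction.\<close>
  have "g (c *\<^sub>C y) = c *\<^sub>C g y" for c y
  proof -
    have "inner x (g (c *\<^sub>C y)) = inner x (c *\<^sub>C g y)" for x
      by (metis adj assms(2) bounded_clinear_scaleC inner_scaleC complex_cnj_cnj)
    then show ?thesis
      using inner_eq_zero_iff[of "g (c *\<^sub>C y) - c *\<^sub>C g y"] by (simp add: inner_diff_right)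
  qed
  moreover have "bounded_linear g"
    unfolding g_def[abs_def]
    by (intro bounded_linear_sum bounded_linear_scaleR_left[THEN bounded_linear_compose]
        bounded_linear_inner_left)
  ultimately show ?thesis
    using that[of g] assms(2) adj by (simp add: adjoint_pair_def bounded_clinear_def)
qed

section \<open>Everywhere defined operators\<close>

definition op_graph :: "('a \<Rightarrow> 'b) \<Rightarrow> ('a \<times> 'b) set" where
  "op_graph f = {(x, y). y = f x}"

lemma op_graph_iff [simp]: "(x, y) \<in> op_graph f \<longleftrightarrow> y = f x"
  by (simp add: op_graph_def)

lemma op_comp_graph: "op_graph f \<circ>\<^sub>o op_graph g = op_graph (\<lambda>x. f (g x))"
  by (auto simp: op_graph_def)

lemma Id_eq_graph: "Id = op_graph (\<lambda>x. x)"
  by (auto simp: op_graph_def)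

lemma op_add_graph: "op_graph f +\<^sub>o op_graph g = op_graph (\<lambda>x. f x + g x)"
  by (auto simp: op_graph_def op_add_def)

lemma op_diff_graph: "op_graph f -\<^sub>o op_graph g = op_graph (\<lambda>x. f x - g x)"
  by (auto simp: op_graph_def op_diff_def)

lemmas op_graph_simps = op_comp_graph Id_eq_graph op_add_graph op_diff_graph

lemma inner_eqI: "x = y" if "\<And>z. inner z x = inner z y" for x y :: "'a::real_inner"
proof -
  have "inner (x - y) (x - y) = 0"
    using that[of "x - y"] by (simp add: inner_diff_right)
  then show ?thesis by simp
qed

lemma adj_graph:
  assumes "adjoint_pair f g"
  shows "adj (op_graph f) = op_graph g"
proof -
  note fg = adjoint_pairD[OF assms]
  have "cinner (f x) y = cinner x (g y)" for x y
  proof (rule complex_eqI)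
    show "Re (cinner (f x) y) = Re (cinner x (g y))"
      using fg(3) by (simp flip: inner_eq_Re_cinner)
    \<comment> \<open>The imaginary part is a real inner product with i y, and \<open>g\<close>
      commutes with i.\<close>
    show "Im (cinner (f x) y) = Im (cinner x (g y))"
      by (simp add: Im_cinner fg(3) bounded_clinear_scaleC[OF fg(2)])
  qed
  moreover have "z = g y" if "\<And>x. cinner (f x) y = cinner x z" for y z
    by (rule inner_eqI) (metis fg(3) inner_eq_Re_cinner that)
  ultimately show ?thesis
    by (auto simp: adj_def op_graph_def)
qed

lemma op_subspaceD:
  assumes "module.subspace (\<lambda>c (x, y). (c *\<^sub>C x, c *\<^sub>C y)) T"
  shows "(0, 0) \<in> T"
    and "(x, y) \<in> T \<Longrightarrow> (x', y') \<in> T \<Longrightarrow> (x + x', y + y') \<in> T"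
    and "(x, y) \<in> T \<Longrightarrow> (c *\<^sub>C x, c *\<^sub>C y) \<in> T"
  using assms by (force simp: module.subspace_def[OF module_prod_scaleC] zero_prod_def)+

lemma op_graph_closed_ops:
  assumes "bounded_clinear f"
  shows "op_graph f \<in> closed_ops"
proof -
  interpret f: bounded_linear f using assms by (rule bounded_clinear_imp_bounded_linear)
  have "module.subspace (\<lambda>c (x, y). (c *\<^sub>C x, c *\<^sub>C y)) (op_graph f)"
    unfolding module.subspace_def[OF module_prod_scaleC]
    by (auto simp: zero_prod_def f.zero f.add bounded_clinear_scaleC[OF assms])
  moreover have "closed (op_graph f)"
    unfolding op_graph_def split_beta'
    by (intro closed_Collect_eq f.continuous_on continuous_intros)
  moreover have "Domain (op_graph f) = UNIV"
    by (auto simp: op_graph_def)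
  ultimately show ?thesis
    by (simp add: closed_ops_def single_valued_def)
qed

lemma pos_selfadjoint_graph:
  assumes "posdef Q"
  shows "pos_selfadjoint (op_graph Q)"
  using posdef_adjoint[OF assms] posdef_inner_nonneg[OF assms]
  by (auto simp: pos_selfadjoint_def adj_graph op_graph_closed_ops adjoint_pairD(1)
      simp flip: inner_eq_Re_cinner)

text \<open>\<open>B\<close> may a priori be unbounded. As its square is defined everywhere, so is
  \<open>B\<close>, and symmetry gives |b x| = |Q x|, hence boundedness. Then D = b - Q satisfies b
  D = - D Q because the squares agree, and the Sylvester argument yields D = 0.\<close>

lemma pos_selfadjoint_sqrt_unique:
  assumes Q: "posdef Q" and B: "pos_selfadjoint B" and eq: "B \<circ>\<^sub>o B = op_graph (\<lambda>x. Q (Q x))"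
  shows "B = op_graph Q"
proof -
  note Qadj = posdef_adjoint[OF Q]
  note Qd = adjoint_pairD[OF Qadj]
  have mod: "module.subspace (\<lambda>c (x, y). (c *\<^sub>C x, c *\<^sub>C y)) B" and sv: "single_valued B"
    and adjB: "adj B = B" and pos: "\<And>x y. (x, y) \<in> B \<Longrightarrow> 0 \<le> inner y x"
    using B by (auto simp: pos_selfadjoint_def closed_ops_def inner_eq_Re_cinner)
  have "\<exists>y. (x, y) \<in> B" for x
  proof -
    have "(x, Q (Q x)) \<in> B \<circ>\<^sub>o B" by (simp add: eq)
    then show ?thesis by blast
  qed
  then obtain b where b: "\<And>x. (x, b x) \<in> B" by metis
  have B_iff: "(x, y) \<in> B \<longleftrightarrow> y = b x" for x y
    using b sv by (metis single_valuedD)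
  have add: "b (x + y) = b x + b y" and scale: "b (c *\<^sub>C x) = c *\<^sub>C b x" for x y c
    using op_subspaceD(2)[OF mod b b] op_subspaceD(3)[OF mod b] by (simp_all add: B_iff)
  have bb: "b (b x) = Q (Q x)" for x
  proof -
    have "(x, b (b x)) \<in> B \<circ>\<^sub>o B" using b by blast
    then show ?thesis by (simp add: eq)
  qed
  have sym: "inner (b x) y = inner x (b y)" for x y
  proof -
    have "(y, b y) \<in> adj B" using b adjB by simp
    then have "cinner (b x) y = cinner x (b y)" using b[of x] by (auto simp: adj_def)
    then show ?thesis by (simp add: inner_eq_Re_cinner)
  qed
  have norm_b: "norm (b x) = norm (Q x)" for x
    by (simp add: norm_eq_sqrt_inner sym bb Qd(3))
  obtain M where M: "\<And>x. norm (Q x) \<le> norm x * M"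
    using bounded_linear.bounded[OF bounded_clinear_imp_bounded_linear[OF Qd(1)]] by blast
  have "bounded_linear b"
    by (rule bounded_linear_intro[where K = M]) (simp_all add: add scale scaleR_scaleC norm_b M)
  then have bl: "bounded_linear (\<lambda>x. b x - Q x)"
    using bounded_clinear_imp_bounded_linear[OF Qd(1)] by (rule bounded_linear_sub)
  interpret b: bounded_linear b by fact
  interpret q: bounded_linear Q by (rule bounded_clinear_imp_bounded_linear[OF Qd(1)])
  have "b x - Q x = 0" for x
    by (rule posdef_sylvester[OF Q bl, of b]) (simp_all add: pos[OF b] b.diff bb)
  then show ?thesis
    using B_iff by (auto simp: op_graph_def)
qed

lemma op_sqrt_graph:
  assumes "posdef Q" "\<And>x. Q (Q x) = A x"
  shows "op_sqrt (op_graph A) = op_graph Q"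
  unfolding op_sqrt_def
proof (rule the_equality)
  show "pos_selfadjoint (op_graph Q) \<and> op_graph Q \<circ>\<^sub>o op_graph Q = op_graph A"
    using assms by (simp add: pos_selfadjoint_graph op_comp_graph)
  show "B = op_graph Q" if "pos_selfadjoint B \<and> B \<circ>\<^sub>o B = op_graph A" for B
    using that pos_selfadjoint_sqrt_unique[OF assms(1), of B] assms(2) by simp
qed

text \<open>Projecting \<open>(0, y)\<close> onto the graph of \<open>T\<close> solves \<open>(I + TT\<^sup>*) z = y\<close>.  In finite
  dimension the injective solution operator is onto, so \<open>T\<^sup>*\<close> is everywhere defined.\<close>

lemma closed_ops_finite_codomain:
  fixes T :: "('h::complex_hilbert_space, 'k::complex_hilbert_space) operator"
  assumes fin: "\<exists>B :: 'k set. finite B \<and> span B = UNIV" and T: "T \<in> closed_ops"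
  obtains t t' where "T = op_graph t" "adjoint_pair t t'"
proof -
  have cl: "closed T" and sv: "single_valued T" and dense: "closure (Domain T) = UNIV"
    and sub: "module.subspace (\<lambda>c (x, y). (c *\<^sub>C x, c *\<^sub>C y)) T"
    using T by (auto simp: closed_ops_def)
  have T0: "(0, 0) \<in> T"
    and Tadd: "\<And>x y x' y'. (x, y) \<in> T \<Longrightarrow> (x', y') \<in> T \<Longrightarrow> (x + x', y + y') \<in> T"
    and TC: "\<And>c x y. (x, y) \<in> T \<Longrightarrow> (c *\<^sub>C x, c *\<^sub>C y) \<in> T"
    using op_subspaceD[OF sub] by blast+
  have TR: "(r *\<^sub>R x, r *\<^sub>R y) \<in> T" if "(x, y) \<in> T" for r x y
    using TC[OF that] by (simp add: scaleR_scaleC)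
  have Tdiff: "(x - x', y - y') \<in> T" if "(x, y) \<in> T" "(x', y') \<in> T" for x y x' y'
    using Tadd[OF that(1) TR[OF that(2), of "-1"]] by simp
  have subR: "subspace T"
    using T0 Tadd TR by (auto simp: subspace_def zero_prod_def)
  \<comment> \<open>The adjoint of \<open>T\<close> as a relation, tested with the real inner
    product.\<close>
  define A where "A y z \<longleftrightarrow> (\<forall>x w. (x, w) \<in> T \<longrightarrow> inner w y = inner x z)" for y z
  have A_unique: "z = z'" if "A y z" "A y z'" for y z z'
  proof -
    have "Domain T \<subseteq> {x. inner x (z - z') = 0}"
      using that by (force simp: A_def inner_diff_right)
    then have "closure (Domain T) \<subseteq> {x. inner x (z - z') = 0}"
      by (intro closure_minimal closed_Collect_eq continuous_intros)
    then have "inner (z - z') (z - z') = 0" using dense by blast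
    then show ?thesis by simp
  qed
  have A_add: "A (y + y') (z + z')" if "A y z" "A y' z'" for y z y' z'
    using that by (auto simp: A_def inner_add_right)
  have A_R: "A (r *\<^sub>R y) (r *\<^sub>R z)" if "A y z" for y z r
    using that by (auto simp: A_def)
  have A_C: "A (c *\<^sub>C y) (c *\<^sub>C z)" if "A y z" for y z c
    unfolding A_def
  proof (intro allI impI)
    fix x w assume "(x, w) \<in> T"
    then have "inner (cnj c *\<^sub>C w) y = inner (cnj c *\<^sub>C x) z"
      using that TC[of x w "cnj c"] by (auto simp: A_def)
    then show "inner w (c *\<^sub>C y) = inner x (c *\<^sub>C z)"
      by (simp add: inner_scaleC)
  qed
  have "\<exists>z a. (a, y - z) \<in> T \<and> A z a" for y
  proof -
    obtain p where p: "p \<in> T" "\<And>g. g \<in> T \<Longrightarrow> inner ((0, y) - p) g = 0"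
      using orthogonal_projection_exists[OF subR cl] by metis
    \<comment> \<open>Orthogonality of (- fst p, y - snd p) to the graph says that the adjoint maps
      y - snd p to fst p.\<close>
    have "inner w (y - snd p) = inner x (fst p)" if "(x, w) \<in> T" for x w
      using p(2)[OF that] by (simp add: inner_prod_def inner_diff inner_commute)
    then have "A (y - snd p) (fst p)" by (auto simp: A_def)
    then show ?thesis using p(1) by (intro exI[of _ "y - snd p"] exI[of _ "fst p"]) simp
  qed
  then obtain R \<alpha> where R: "\<And>y. (\<alpha> y, y - R y) \<in> T" "\<And>y. A (R y) (\<alpha> y)" by metis
  \<comment> \<open>Subtracting two solutions equates minus a square with a square, so both
    vanish.\<close>
  have R_unique: "R y = z" if "(a, y - z) \<in> T" "A z a" for y z a
  proof -
    have "A (R y + (-1) *\<^sub>R z) (\<alpha> y + (-1) *\<^sub>R a)"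
      using A_add[OF R(2)[of y] A_R[OF that(2), of "-1"]] .
    then have "inner ((y - R y) - (y - z)) (R y - z) = inner (\<alpha> y - a) (\<alpha> y - a)"
      using Tdiff[OF R(1)[of y] that(1)] by (auto simp: A_def)
    also have "(y - R y) - (y - z) = - (R y - z)" by simp
    finally have "- inner (R y - z) (R y - z) = inner (\<alpha> y - a) (\<alpha> y - a)"
      by (simp only: inner_minus_left)
    then have "inner (R y - z) (R y - z) = 0"
      using inner_ge_zero[of "R y - z"] inner_ge_zero[of "\<alpha> y - a"] by linarith
    then show ?thesis by simp
  qed
  have linR: "linear R"
  proof (rule linearI)
    show "R (x + y) = R x + R y" for x y
      using Tadd[OF R(1)[of x] R(1)[of y]] A_add[OF R(2)[of x] R(2)[of y]]
      by (intro R_unique) (simp_all add: algebra_simps)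
    show "R (r *\<^sub>R x) = r *\<^sub>R R x" for r x
      using TR[OF R(1)[of x], of r] A_R[OF R(2)[of x], of r]
      by (intro R_unique) (simp_all add: algebra_simps)
  qed
  have "inj R"
    unfolding linear_injective_0[OF linR]
  proof (intro allI impI)
    fix y assume "R y = 0"
    then have "A 0 (\<alpha> y)" "(\<alpha> y, y) \<in> T" using R[of y] by auto
    moreover have "A 0 0" by (auto simp: A_def)
    ultimately have "(0, y) \<in> T" using A_unique[of 0 "\<alpha> y" 0] by simp
    then show "y = 0" using T0 sv by (auto dest: single_valuedD)
  qed
  then have "surj R" by (rule linear_inj_imp_surj_finite_span[OF fin linR])
  then have "\<exists>z. A y z" for y using R(2) by (metis surjD)
  then obtain t' where t': "\<And>y. A y (t' y)" by metis
  have t'_add: "t' (x + y) = t' x + t' y" and t'_C: "t' (c *\<^sub>C x) = c *\<^sub>C t' x" for x y c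
    using A_unique[OF t' A_add[OF t' t']] A_unique[OF t' A_C[OF t']] by blast+
  then have "linear t'"
    by (intro linearI) (simp_all add: scaleR_scaleC)
  then have bl': "bounded_linear t'" by (rule linear_bounded_finite_span[OF fin])
  then obtain M where M: "\<And>y. norm (t' y) \<le> norm y * M" "M > 0"
    using bounded_linear.pos_bounded by blast
  \<comment> \<open>|w|^2 is \<open>inner x (t' w)\<close>, so the bound of the adjoint passes to
    \<open>T\<close>.\<close>
  have T_bound: "norm w \<le> M * norm x" if "(x, w) \<in> T" for x w
  proof -
    have "norm w * norm w = inner x (t' w)"
      using t'[of w] that by (auto simp: A_def power2_norm_eq_inner simp flip: power2_eq_square)
    also have "\<dots> \<le> norm x * (norm w * M)"
      by (meson M(1) mult_left_mono norm_cauchy_schwarz norm_ge_zero order_trans)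
    finally have "norm w * norm w \<le> norm w * (M * norm x)" by (simp add: mult_ac)
    then show ?thesis
      using M(2) by (cases "w = 0") simp_all
  qed
  \<comment> \<open>By the bound, images of a sequence from the dense domain converge with it;
    closedness of the graph then provides a value at the limit.\<close>
  have "\<exists>y. (x, y) \<in> T" for x
  proof -
    have "x \<in> closure (Domain T)" using dense by simp
    then obtain xs where xs: "\<And>n. xs n \<in> Domain T" "xs \<longlonglongrightarrow> x"
      by (auto simp: closure_sequential)
    then have "\<forall>n. \<exists>w. (xs n, w) \<in> T" by blast
    then obtain ws where ws: "\<And>n. (xs n, ws n) \<in> T" by metis
    have "Cauchy ws"
    proof (rule metric_CauchyI)
      fix e :: real assume "e > 0"
      then obtain n0 where n0: "\<And>m n. m \<ge> n0 \<Longrightarrow> n \<ge> n0 \<Longrightarrow> dist (xs m) (xs n) < e / M"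
        using metric_CauchyD[OF LIMSEQ_imp_Cauchy[OF xs(2)], of "e / M"] M(2) by auto
      have "dist (ws m) (ws n) < e" if "m \<ge> n0" "n \<ge> n0" for m n
      proof -
        have "dist (ws m) (ws n) \<le> M * dist (xs m) (xs n)"
          using T_bound[OF Tdiff[OF ws[of m] ws[of n]]] by (simp add: dist_norm)
        also have "\<dots> < e"
          using n0[OF that] M(2) by (simp add: field_simps)
        finally show ?thesis .
      qed
      then show "\<exists>n0. \<forall>m\<ge>n0. \<forall>n\<ge>n0. dist (ws m) (ws n) < e" by blast
    qed
    then obtain w where "ws \<longlonglongrightarrow> w" using Cauchy_convergent convergent_def by blast
    then have "(\<lambda>n. (xs n, ws n)) \<longlonglongrightarrow> (x, w)" using xs(2) by (intro tendsto_Pair)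
    then have "(x, w) \<in> T"
      using closed_sequentially[OF cl, of "\<lambda>n. (xs n, ws n)" "(x, w)"] ws by simp
    then show ?thesis by blast
  qed
  then obtain t where t: "\<And>x. (x, t x) \<in> T" by metis
  have T_iff: "(x, y) \<in> T \<longleftrightarrow> y = t x" for x y
    using t sv by (metis single_valuedD)
  have "bounded_linear t"
  proof (rule bounded_linear_intro)
    show "t (x + y) = t x + t y" "t (r *\<^sub>R x) = r *\<^sub>R t x" for x y r
      using Tadd[OF t[of x] t[of y]] TR[OF t[of x]] by (simp_all add: T_iff)
    show "norm (t x) \<le> norm x * M" for x
      using T_bound[OF t[of x]] by (simp add: mult.commute)
  qed
  moreover have "t (c *\<^sub>C x) = c *\<^sub>C t x" for c x
    using TC[OF t[of x]] by (simp add: T_iff)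
  moreover have "inner (t x) y = inner x (t' y)" for x y
    using t'[of y] t[of x] by (auto simp: A_def)
  ultimately have "adjoint_pair t t'"
    using bl' t'_C by (simp add: adjoint_pair_def bounded_clinear_def)
  moreover have "T = op_graph t"
    using T_iff by (auto simp: op_graph_def)
  ultimately show ?thesis using that by blast
qed

text \<open>The lower bound for the inverse comes from inner (E x) x = inner (C (E x)) (E x) \<ge> c
  |E x|^2 and |x| \<le> M |E x|.\<close>

lemma posdef_inverse_finite_span:
  fixes C :: "'k::complex_hilbert_space \<Rightarrow> 'k"
  assumes fin: "\<exists>B :: 'k set. finite B \<and> span B = UNIV" and C: "posdef C"
  obtains E where "posdef E" "\<And>x. E (C x) = x" "\<And>x. C (E x) = x"
proof -
  note Cd = adjoint_pairD[OF posdef_adjoint[OF C]]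
  interpret C: bounded_linear C by (rule bounded_clinear_imp_bounded_linear[OF Cd(1)])
  define E where "E = inv C"
  have EC: "E (C x) = x" for x
    unfolding E_def by (rule inv_f_f[OF posdef_inj[OF C]])
  have CE: "C (E x) = x" for x
    unfolding E_def
    using linear_inj_imp_surj_finite_span[OF fin C.linear posdef_inj[OF C]] by (rule surj_f_inv_f)
  have E_add: "E (x + y) = E x + E y" and E_C: "E (c *\<^sub>C x) = c *\<^sub>C E x" for x y c
    by (metis C.add CE EC, metis CE EC Cd(1) bounded_clinear_scaleC)
  have "linear E"
    by (intro linearI) (simp_all add: E_add E_C scaleR_scaleC)
  then have "bounded_linear E" by (rule linear_bounded_finite_span[OF fin])
  then have adj: "adjoint_pair E E"
    unfolding adjoint_pair_def bounded_clinear_def using E_C by (metis CE Cd(3))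
  obtain c where c: "c > 0" "\<And>x. c * (norm x)\<^sup>2 \<le> inner (C x) x"
    using C by (auto simp: posdef_def)
  obtain M where M: "M > 0" "\<And>x. norm (C x) \<le> norm x * M"
    using C.pos_bounded by blast
  have "c / M\<^sup>2 * (norm x)\<^sup>2 \<le> inner (E x) x" for x
  proof -
    have "norm x \<le> norm (E x) * M" using M(2)[of "E x"] by (simp add: CE)
    then have "(norm x)\<^sup>2 \<le> (norm (E x))\<^sup>2 * M\<^sup>2"
      by (metis norm_ge_zero power_mono power_mult_distrib)
    then have "c / M\<^sup>2 * (norm x)\<^sup>2 \<le> c * (norm (E x))\<^sup>2"
      using c(1) M(1) by (simp add: field_simps)
    also have "\<dots> \<le> inner (E x) x"
      using c(2)[of "E x"] by (simp add: CE inner_commute)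
    finally show ?thesis .
  qed
  then have "posdef E"
    unfolding posdef_def using adj c(1) M(1) by (metis divide_pos_pos zero_less_power)
  then show ?thesis using that EC CE by blast
qed

section \<open>The metric in ball coordinates\<close>

locale op_roots =
  fixes t :: "'h::complex_hilbert_space \<Rightarrow> 'k::complex_hilbert_space" and t' P Q
  assumes adjoint: "adjoint_pair t t'"
    and P: "posdef P" "\<And>x. P (P x) = x + t' (t x)"
    and Q: "posdef Q" "\<And>y. Q (Q y) = y + t (t' y)"
begin

lemma bounded_linear_t: "bounded_linear t"
  and bounded_linear_t': "bounded_linear t'"
  and bounded_linear_P: "bounded_linear P"
  and bounded_linear_Q: "bounded_linear Q"
  using adjoint_pairD(1,2)[OF adjoint] adjoint_pairD(1)[OF posdef_adjoint[OF P(1)]]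
    adjoint_pairD(1)[OF posdef_adjoint[OF Q(1)]]
  by (simp_all add: bounded_clinear_def)

sublocale t: bounded_linear t by (rule bounded_linear_t)
sublocale t': bounded_linear t' by (rule bounded_linear_t')
sublocale P: bounded_linear P by (rule bounded_linear_P)
sublocale Q: bounded_linear Q by (rule bounded_linear_Q)

lemma inner_t: "inner (t x) y = inner x (t' y)"
  by (rule adjoint_pairD(3)[OF adjoint])

lemma inner_t': "inner (t' y) x = inner y (t x)"
  by (metis inner_commute inner_t)

lemma inner_P: "inner (P x) y = inner x (P y)"
  by (rule adjoint_pairD(3)[OF posdef_adjoint[OF P(1)]])

lemma inner_Q: "inner (Q x) y = inner x (Q y)"
  by (rule adjoint_pairD(3)[OF posdef_adjoint[OF Q(1)]])

lemma norm_Q: "(norm (Q y))\<^sup>2 = (norm y)\<^sup>2 + (norm (t' y))\<^sup>2"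
  unfolding power2_norm_eq_inner by (simp add: inner_Q Q(2) inner_add_right inner_t')

lemma norm_P: "(norm (P x))\<^sup>2 = (norm x)\<^sup>2 + (norm (t x))\<^sup>2"
  unfolding power2_norm_eq_inner by (simp add: inner_P P(2) inner_add_right inner_t)

text \<open>The squares intertwine, t P^2 = Q^2 t. Hence D = t P - Q t satisfies Q D = - D P, and
  the Sylvester argument gives D = 0.\<close>

lemma intertwine: "t (P x) = Q (t x)"
proof -
  have "bounded_linear (\<lambda>x. t (P x) - Q (t x))"
    using bounded_linear_compose[OF bounded_linear_t bounded_linear_P]
      bounded_linear_compose[OF bounded_linear_Q bounded_linear_t]
    by (rule bounded_linear_sub)
  then have "t (P x) - Q (t x) = 0"
    by (rule posdef_sylvester[OF P(1), where B = Q])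
      (simp_all add: posdef_inner_nonneg[OF Q(1)] Q.diff P(2) Q(2) t.add)
  then show ?thesis by simp
qed

text \<open>By \<open>intertwine\<close> the mixed terms of the two squares coincide;
  \<open>norm_P\<close> and \<open>norm_Q\<close> account for the rest.\<close>

lemma norm_hyperbolic:
  "(norm (Q x - t v))\<^sup>2 - (norm (P v - t' x))\<^sup>2 = (norm x)\<^sup>2 - (norm v)\<^sup>2"
proof -
  have "inner (Q x) (t v) = inner (P v) (t' x)"
    by (metis inner_Q inner_commute inner_t intertwine)
  moreover have "(norm (Q x - t v))\<^sup>2 = (norm (Q x))\<^sup>2 + (norm (t v))\<^sup>2 - 2 * inner (Q x) (t v)"
    "(norm (P v - t' x))\<^sup>2 = (norm (P v))\<^sup>2 + (norm (t' x))\<^sup>2 - 2 * inner (P v) (t' x)"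
    by (simp_all add: power2_norm_eq_inner inner_diff inner_commute)
  ultimately show ?thesis
    by (simp add: norm_P norm_Q)
qed

text \<open>With W = Q x - t v and U = P v - t' x one recovers x = Q W + t U, a row of the inverse
  block operator, and |U| \<le> |W| by \<open>norm_hyperbolic\<close>. This is the source of
  strictness for contractions in a ball.\<close>

lemma norm_le_hyperbolic:
  obtains M where "0 < M" "\<And>x v. norm v \<le> norm x \<Longrightarrow> norm x \<le> M * norm (Q x - t v)"
proof
  show "0 < onorm Q + onorm t + 1"
    using onorm_pos_le[OF bounded_linear_Q] onorm_pos_le[OF bounded_linear_t] by linarith
  fix x :: 'k and v :: 'h assume v: "norm v \<le> norm x"
  let ?W = "Q x - t v" and ?U = "P v - t' x"
  have "(norm v)\<^sup>2 \<le> (norm x)\<^sup>2" using v by (simp add: power_mono)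
  then have "(norm ?U)\<^sup>2 \<le> (norm ?W)\<^sup>2"
    using norm_hyperbolic[of x v] by linarith
  then have UW: "norm ?U \<le> norm ?W"
    by (rule power2_le_imp_le) simp
  have "norm x = norm (Q ?W + t ?U)"
    by (simp add: Q.diff t.diff Q(2) intertwine)
  also have "\<dots> \<le> onorm Q * norm ?W + onorm t * norm ?U"
    by (intro order_trans[OF norm_triangle_ineq] add_mono onorm bounded_linear_Q bounded_linear_t)
  also have "\<dots> \<le> onorm Q * norm ?W + onorm t * norm ?W"
    by (intro add_left_mono mult_left_mono UW onorm_pos_le bounded_linear_t)
  also have "\<dots> \<le> (onorm Q + onorm t + 1) * norm ?W"
    by (simp add: algebra_simps)
  finally show "norm x \<le> (onorm Q + onorm t + 1) * norm ?W" .
qed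

lemma adj_op: "adj (op_graph t) = op_graph t'"
  by (rule adj_graph[OF adjoint])

lemma op_sqrt_P: "op_sqrt (Id +\<^sub>o adj (op_graph t) \<circ>\<^sub>o op_graph t) = op_graph P"
  unfolding adj_op op_graph_simps by (rule op_sqrt_graph[OF P])

lemma op_sqrt_Q: "op_sqrt (Id +\<^sub>o op_graph t \<circ>\<^sub>o adj (op_graph t)) = op_graph Q"
  unfolding adj_op op_graph_simps by (rule op_sqrt_graph[OF Q])

end

lemma posdef_ident_add_adjoint:
  assumes "adjoint_pair f f'"
  shows "posdef (\<lambda>x. x + f' (f x))"
proof -
  have "adjoint_pair (\<lambda>x. x + f' (f x)) (\<lambda>x. x + f' (f x))"
    using adjoint_pair_compose[OF adjoint_pair_commute[OF assms] assms]
    by (rule adjoint_pair_add[OF adjoint_pair_ident])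
  moreover have "1 * (norm x)\<^sup>2 \<le> inner (x + f' (f x)) x" for x
    using inner_ge_zero[of "f x"] adjoint_pairD(3)[OF assms, of x "f x"]
    by (simp add: inner_add_left power2_norm_eq_inner inner_commute[of "f' _"])
  ultimately show ?thesis
    unfolding posdef_def by (metis zero_less_one)
qed

lemma op_roots_exists:
  assumes "adjoint_pair t t'"
  obtains P Q where "op_roots t t' P Q"
proof -
  obtain P where "posdef P" "\<And>x. P (P x) = x + t' (t x)"
    using posdef_sqrt_exists[OF posdef_ident_add_adjoint[OF assms]] by metis
  moreover obtain Q where "posdef Q" "\<And>y. Q (Q y) = y + t (t' y)"
    using posdef_sqrt_exists[OF posdef_ident_add_adjoint[OF adjoint_pair_commute[OF assms]]]
    by metis
  ultimately show ?thesis
    using that[of P Q] assms by (simp add: op_roots_def)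
qed

lemma artanh_le_iff:
  fixes x r :: real
  assumes "0 \<le> x" "x < 1"
  shows "artanh x \<le> r \<longleftrightarrow> x \<le> tanh r"
proof -
  have "artanh x \<le> r \<longleftrightarrow> ln ((1 + x) / (1 - x)) \<le> ln (exp (2 * r))"
    by (simp add: artanh_def mult.commute)
  also have "\<dots> \<longleftrightarrow> (1 + x) / (1 - x) \<le> exp (2 * r)"
    using assms by (subst ln_le_cancel_iff) auto
  also have "\<dots> \<longleftrightarrow> x \<le> (1 - exp (- 2 * r)) / (1 + exp (- 2 * r))"
  proof -
    define w where "w = exp (- 2 * r)"
    have w: "w > 0" "exp (2 * r) = 1 / w"
      by (simp_all add: w_def exp_minus divide_inverse)
    have "(1 + x) / (1 - x) \<le> 1 / w \<longleftrightarrow> (1 + x) * w \<le> 1 - x"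
      using w(1) assms by (simp add: field_simps)
    moreover have "x \<le> (1 - w) / (1 + w) \<longleftrightarrow> x * (1 + w) \<le> 1 - w"
      using w(1) by (simp add: pos_le_divide_eq)
    ultimately show ?thesis
      unfolding w(2) w_def[symmetric] by (auto simp: algebra_simps)
  qed
  finally show ?thesis
    by (simp add: tanh_real_altdef)
qed

text \<open>Since \<open>\<parallel>R y\<parallel>\<^sup>2 - \<parallel>L y\<parallel>\<^sup>2 = \<parallel>y\<parallel>\<^sup>2\<close>, the distance is at most \<open>r\<close> iff
  \<open>\<parallel>R y\<parallel> \<le> cosh r * \<parallel>y\<parallel>\<close> for all \<open>y\<close>.\<close>

lemma op_dist_le_iff:
  assumes T: "op_roots t t' P Q" and S: "op_roots s s' Ps Qs" and "0 \<le> r"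
  shows "op_dist (op_graph t) (op_graph s) \<le> r \<longleftrightarrow>
    (\<forall>y. (1 - (tanh r)\<^sup>2) * (norm (Q (Qs y) - t (s' y)))\<^sup>2 \<le> (norm y)\<^sup>2)"
proof -
  interpret T: op_roots t t' P Q by (rule T)
  interpret S: op_roots s s' Ps Qs by (rule S)
  define L where "L y = P (s' y) - t' (Qs y)" for y
  define R where "R y = Q (Qs y) - t (s' y)" for y
  have L_op: "L_op (op_graph t) (op_graph s) = op_graph L"
    unfolding L_op_def T.op_sqrt_P S.op_sqrt_Q unfolding T.adj_op S.adj_op op_graph_simps
    by (simp add: L_def[abs_def])
  have R_op: "R_op (op_graph s) (op_graph t) = op_graph R"
    unfolding R_op_def T.op_sqrt_Q S.op_sqrt_Q unfolding S.adj_op op_graph_simps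
    by (simp add: R_def[abs_def])
  have RL: "(norm (R y))\<^sup>2 = (norm (L y))\<^sup>2 + (norm y)\<^sup>2" for y
    using T.norm_hyperbolic[of "Qs y" "s' y"] S.norm_Q[of y] by (simp add: L_def R_def)
  \<comment> \<open>The operator norm is a supremum over vectors u = R y; parametrising by y removes
    the converse relation.\<close>
  define X where "X = (\<lambda>y. norm (L y)) ` {y. norm (R y) \<le> 1}"
  have "(u, v) \<in> op_graph L \<circ>\<^sub>o (op_graph R)\<inverse> \<longleftrightarrow> (\<exists>y. u = R y \<and> v = L y)" for u v
    by (auto intro!: relcompI)
  then have "{norm v | u v. (u, v) \<in> L_op (op_graph t) (op_graph s) \<circ>\<^sub>o (R_op (op_graph s) (op_graph t))\<inverse> \<and>
      norm u \<le> 1} = X"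
    unfolding X_def L_op R_op by auto
  then have dist: "op_dist (op_graph t) (op_graph s) = artanh (Sup X)"
    by (simp add: op_dist_def op_norm_def)
  have linL: "L (c *\<^sub>R y) = c *\<^sub>R L y" and linR: "R (c *\<^sub>R y) = c *\<^sub>R R y" for c y
    by (simp_all add: L_def R_def T.P.scaleR T.Q.scaleR T.t.scaleR T.t'.scaleR S.t'.scaleR
        S.Q.scaleR scaleR_diff_right)
  have "bounded_linear R"
    unfolding R_def[abs_def]
    by (rule bounded_linear_sub[OF
          bounded_linear_compose[OF T.bounded_linear_Q S.bounded_linear_Q]
          bounded_linear_compose[OF T.bounded_linear_t S.bounded_linear_t']])
  then obtain M where M: "M > 0" "\<And>y. norm (R y) \<le> norm y * M"
    using bounded_linear.pos_bounded by blast
  \<comment> \<open>\<open>artanh\<close> inverts tanh only below 1, so the supremum must stay away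
    from 1. This bound follows from |L y|^2 = |R y|^2 - |y|^2 and |R y| \<le> (M + 1) |y|.\<close>
  define \<kappa> where "\<kappa> = sqrt (1 - 1 / (M + 1)\<^sup>2)"
  have \<kappa>: "0 \<le> 1 - 1 / (M + 1)\<^sup>2" "\<kappa> < 1"
    using M(1) by (simp_all add: \<kappa>_def)
  have X_le: "x \<le> \<kappa>" if x: "x \<in> X" for x
  proof -
    obtain y where y: "x = norm (L y)" "norm (R y) \<le> 1"
      using x by (auto simp: X_def)
    have "norm (R y) \<le> norm y * (M + 1)"
      using M(2)[of y] by (simp add: distrib_left add_increasing2)
    then have "(norm (R y))\<^sup>2 \<le> (norm y)\<^sup>2 * (M + 1)\<^sup>2"
      by (metis norm_ge_zero power_mono power_mult_distrib)
    then have "(norm (R y))\<^sup>2 / (M + 1)\<^sup>2 \<le> (norm y)\<^sup>2"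
      using M(1) by (simp add: divide_le_eq)
    then have "(norm (L y))\<^sup>2 \<le> (1 - 1 / (M + 1)\<^sup>2) * (norm (R y))\<^sup>2"
      using RL[of y] by (simp add: left_diff_distrib)
    also have "\<dots> \<le> (1 - 1 / (M + 1)\<^sup>2) * 1"
      using y(2) by (intro mult_left_mono \<kappa>(1)) (simp add: power_le_one)
    finally show ?thesis
      unfolding y(1) \<kappa>_def by (intro real_le_rsqrt) simp
  qed
  have "R 0 = 0" "L 0 = 0" using linR[of 0 0] linL[of 0 0] by simp_all
  then have X0: "0 \<in> X" by (force simp: X_def)
  have bdd: "bdd_above X" by (intro bdd_aboveI[of _ \<kappa>] X_le)
  have "Sup X \<le> \<kappa>" using X_le X0 by (intro cSup_least) auto
  moreover have "0 \<le> Sup X" using X0 bdd by (intro cSup_upper)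
  ultimately have "artanh (Sup X) \<le> r \<longleftrightarrow> Sup X \<le> tanh r"
    using \<kappa>(2) by (intro artanh_le_iff) auto
  also have "\<dots> \<longleftrightarrow> (\<forall>x\<in>X. x \<le> tanh r)"
    using X0 bdd by (intro cSup_le_iff) auto
  also have "\<dots> \<longleftrightarrow> (\<forall>y. norm (L y) \<le> tanh r * norm (R y))"
  proof
    assume X: "\<forall>x\<in>X. x \<le> tanh r"
    show "\<forall>y. norm (L y) \<le> tanh r * norm (R y)"
    proof
      fix y
      show "norm (L y) \<le> tanh r * norm (R y)"
      proof (cases "R y = 0")
        case True
        then have "L y = 0" using RL[of y] \<open>L 0 = 0\<close> by (auto simp: add_nonneg_eq_0_iff)
        then show ?thesis using \<open>0 \<le> r\<close> by simp
      next
        case False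
        let ?y = "inverse (norm (R y)) *\<^sub>R y"
        have "norm (R ?y) \<le> 1" using False by (simp add: linR)
        then have "norm (L ?y) \<le> tanh r" using X by (auto simp: X_def)
        then show ?thesis using False by (simp add: linL field_simps)
      qed
    qed
  next
    assume le: "\<forall>y. norm (L y) \<le> tanh r * norm (R y)"
    show "\<forall>x\<in>X. x \<le> tanh r"
    proof
      fix x assume "x \<in> X"
      then obtain y where y: "x = norm (L y)" "norm (R y) \<le> 1" by (auto simp: X_def)
      have "tanh r * norm (R y) \<le> tanh r"
        using y(2) \<open>0 \<le> r\<close> by (simp add: mult_left_le)
      then show "x \<le> tanh r"
        unfolding y(1) using le by (blast intro: order_trans)
    qed
  qed
  also have "\<dots> \<longleftrightarrow> (\<forall>y. (norm (L y))\<^sup>2 \<le> (tanh r * norm (R y))\<^sup>2)"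
    using \<open>0 \<le> r\<close> by (auto intro: power2_le_imp_le power_mono)
  also have "\<dots> \<longleftrightarrow> (\<forall>y. (1 - (tanh r)\<^sup>2) * (norm (R y))\<^sup>2 \<le> (norm y)\<^sup>2)"
    by (simp add: RL power_mult_distrib algebra_simps)
  finally show ?thesis
    by (simp add: dist R_def)
qed

text \<open>The Hilbert ball coordinate of \<open>S\<close> is the strict contraction
  \<open>S\<^sup>* (I + SS\<^sup>*)\<^bsup>-1/2\<^esup>\<close>.\<close>

definition ball_coordinate :: "('k::complex_hilbert_space \<Rightarrow>\<^sub>L 'h::complex_hilbert_space) \<Rightarrow>
    ('h, 'k) operator \<Rightarrow> bool" where
  "ball_coordinate B S \<longleftrightarrow> bounded_clinear (blinfun_apply B) \<and>
    (\<exists>s s' P Q. S = op_graph s \<and> op_roots s s' P Q \<and> (\<forall>y. blinfun_apply B (Q y) = s' y))"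

lemma ball_coordinate_exists:
  fixes S :: "('h::complex_hilbert_space, 'k::complex_hilbert_space) operator"
  assumes fin: "\<exists>B :: 'k set. finite B \<and> span B = UNIV" and S: "S \<in> closed_ops"
  obtains B where "ball_coordinate B S"
proof -
  obtain s s' where s: "S = op_graph s" "adjoint_pair s s'"
    using closed_ops_finite_codomain[OF fin S] by metis
  obtain P Q where roots: "op_roots s s' P Q"
    using op_roots_exists[OF s(2)] by metis
  interpret op_roots s s' P Q by (rule roots)
  obtain E where E: "posdef E" "\<And>y. E (Q y) = y"
    using posdef_inverse_finite_span[OF fin Q(1)] by metis
  have bc: "bounded_clinear (\<lambda>x. s' (E x))"
    by (rule bounded_clinear_compose[OF adjoint_pairD(2)[OF s(2)]
          adjoint_pairD(1)[OF posdef_adjoint[OF E(1)]]])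
  then have "blinfun_apply (Blinfun (\<lambda>x. s' (E x))) = (\<lambda>x. s' (E x))"
    by (intro bounded_linear_Blinfun_apply bounded_clinear_imp_bounded_linear)
  then have "ball_coordinate (Blinfun (\<lambda>x. s' (E x))) S"
    unfolding ball_coordinate_def using bc s(1) roots E(2)
    by (intro conjI exI[of _ s] exI[of _ s'] exI[of _ P] exI[of _ Q]) simp_all
  then show ?thesis using that by blast
qed

text \<open>Complex linearity is a separate conjunct because \<open>\<Rightarrow>\<^sub>L\<close>
  consists of real-linear maps.\<close>

definition coordinate_ball :: "('h::complex_hilbert_space \<Rightarrow> 'k::complex_hilbert_space) \<Rightarrow>
    ('k \<Rightarrow> 'k) \<Rightarrow> real \<Rightarrow> ('k \<Rightarrow>\<^sub>L 'h) set" where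
  "coordinate_ball t Q r = {B. bounded_clinear (blinfun_apply B) \<and>
    (\<forall>x. (norm (blinfun_apply B x))\<^sup>2 + (1 - (tanh r)\<^sup>2) * (norm (Q x - t (blinfun_apply B x)))\<^sup>2
      \<le> (norm x)\<^sup>2)}"

lemma tanh_power2_less_1: "(tanh r)\<^sup>2 < 1" for r :: real
  using tanh_real_bounds[of r] by (auto simp: abs_square_less_1 abs_less_iff)

text \<open>Substitute x = Qs y, which runs over all of K. Then B x = s' y, and |x|^2 = |y|^2 + |s'
  y|^2 cancels the first summand, leaving the criterion of \<open>op_dist_le_iff\<close>.\<close>

lemma ball_coordinate_op_dist:
  fixes t :: "'h::complex_hilbert_space \<Rightarrow> 'k::complex_hilbert_space"
  assumes fin: "\<exists>B :: 'k set. finite B \<and> span B = UNIV"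
    and T: "op_roots t t' P Q" and B: "ball_coordinate B S" and "0 \<le> r"
  shows "op_dist (op_graph t) S \<le> r \<longleftrightarrow> B \<in> coordinate_ball t Q r"
proof -
  obtain s s' Ps Qs where S: "S = op_graph s" "op_roots s s' Ps Qs" "\<And>y. blinfun_apply B (Qs y) = s' y"
    and bc: "bounded_clinear (blinfun_apply B)"
    using B by (auto simp: ball_coordinate_def)
  interpret S: op_roots s s' Ps Qs by (rule S)
  have "surj Qs"
    by (rule linear_inj_imp_surj_finite_span[OF fin S.Q.linear posdef_inj[OF S.Q(1)]])
  then have all_Qs: "(\<forall>x. \<phi> x) \<longleftrightarrow> (\<forall>y. \<phi> (Qs y))" for \<phi>
    by (metis surjD)
  have "B \<in> coordinate_ball t Q r \<longleftrightarrow>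
      (\<forall>y. (norm (s' y))\<^sup>2 + (1 - (tanh r)\<^sup>2) * (norm (Q (Qs y) - t (s' y)))\<^sup>2 \<le> (norm (Qs y))\<^sup>2)"
    unfolding coordinate_ball_def using bc by (subst (1) all_Qs) (simp add: S(3))
  then show ?thesis
    unfolding S(1) op_dist_le_iff[OF T S(2) \<open>0 \<le> r\<close>] by (simp add: S.norm_Q)
qed

text \<open>With \<open>C = (I - B\<^sup>*B)\<^bsup>1/2\<^esup>\<close> the operator is \<open>S = C\<^sup>-\<^sup>1 B\<^sup>*\<close>, for which
  \<open>(I + SS\<^sup>*)\<^bsup>1/2\<^esup> = C\<^sup>-\<^sup>1\<close>.\<close>

lemma ball_coordinate_surj:
  fixes t :: "'h::complex_hilbert_space \<Rightarrow> 'k::complex_hilbert_space"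
  assumes fin: "\<exists>B :: 'k set. finite B \<and> span B = UNIV"
    and T: "op_roots t t' P Q" and B: "B \<in> coordinate_ball t Q r"
  obtains S where "S \<in> closed_ops" "ball_coordinate B S"
proof -
  interpret T: op_roots t t' P Q by (rule T)
  define b where "b = blinfun_apply B"
  have bc: "bounded_clinear b"
    and le: "\<And>x. (norm (b x))\<^sup>2 + (1 - (tanh r)\<^sup>2) * (norm (Q x - t (b x)))\<^sup>2 \<le> (norm x)\<^sup>2"
    using B by (auto simp: coordinate_ball_def b_def)
  obtain b' where b': "adjoint_pair b b'"
    using adjoint_exists_finite_span[OF fin bc] by metis
  obtain M where M: "0 < M" "\<And>x v. norm v \<le> norm x \<Longrightarrow> norm x \<le> M * norm (Q x - t v)"
    using T.norm_le_hyperbolic by metis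
  have "posdef (\<lambda>x. x - b' (b x))"
    unfolding posdef_def
  proof (intro conjI exI allI)
    show "adjoint_pair (\<lambda>x. x - b' (b x)) (\<lambda>x. x - b' (b x))"
      using adjoint_pair_compose[OF adjoint_pair_commute[OF b'] b']
      by (rule adjoint_pair_diff[OF adjoint_pair_ident])
    \<comment> \<open>The weight of the second summand in the ball condition, divided by the price
      M^2 of replacing |Q x - t (b x)| by |x|.\<close>
    show "0 < (1 - (tanh r)\<^sup>2) / M\<^sup>2"
      using M(1) tanh_power2_less_1[of r] by simp
    fix x
    have "0 \<le> (1 - (tanh r)\<^sup>2) * (norm (Q x - t (b x)))\<^sup>2"
      using tanh_power2_less_1[of r] by simp
    then have "(norm (b x))\<^sup>2 \<le> (norm x)\<^sup>2" using le[of x] by linarith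
    then have "norm (b x) \<le> norm x" by (rule power2_le_imp_le) simp
    then have "norm x \<le> M * norm (Q x - t (b x))" by (rule M(2))
    then have "(norm x)\<^sup>2 \<le> M\<^sup>2 * (norm (Q x - t (b x)))\<^sup>2"
      unfolding power_mult_distrib[symmetric] by (rule power_mono) simp
    then have "(norm x)\<^sup>2 / M\<^sup>2 \<le> (norm (Q x - t (b x)))\<^sup>2"
      using M(1) by (simp add: field_simps)
    then have "(1 - (tanh r)\<^sup>2) * ((norm x)\<^sup>2 / M\<^sup>2) \<le> (1 - (tanh r)\<^sup>2) * (norm (Q x - t (b x)))\<^sup>2"
      using tanh_power2_less_1[of r] by (intro mult_left_mono) auto
    also have "\<dots> \<le> (norm x)\<^sup>2 - (norm (b x))\<^sup>2"
      using le[of x] by linarith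
    also have "\<dots> = inner (x - b' (b x)) x"
      by (simp add: power2_norm_eq_inner inner_diff adjoint_pairD(3)[OF b'] inner_commute)
    finally show "(1 - (tanh r)\<^sup>2) / M\<^sup>2 * (norm x)\<^sup>2 \<le> inner (x - b' (b x)) x"
      by simp
  qed
  from posdef_sqrt_exists[OF this] obtain C where C: "posdef C" "\<And>x. C (C x) = x - b' (b x)"
    by metis
  obtain E where E: "posdef E" "\<And>x. E (C x) = x" "\<And>x. C (E x) = x"
    using posdef_inverse_finite_span[OF fin C(1)] by metis
  interpret E: bounded_linear E
    using adjoint_pairD(1)[OF posdef_adjoint[OF E(1)]] by (rule bounded_clinear_imp_bounded_linear)
  define s where "s x = E (b' x)" for x
  define s' where "s' y = b (E y)" for y
  have adj: "adjoint_pair s s'"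
    unfolding s_def[abs_def] s'_def[abs_def]
    by (rule adjoint_pair_compose[OF posdef_adjoint[OF E(1)] adjoint_pair_commute[OF b']])
  obtain Ps where Ps: "posdef Ps" "\<And>x. Ps (Ps x) = x + s' (s x)"
    using op_roots_exists[OF adj] by (metis op_roots_def)
  \<comment> \<open>C^2 = I - b'b with \<open>E\<close> applied on both sides gives E b'b E = E^2 -
    I.\<close>
  have "E (E y) = y + s (s' y)" for y
  proof -
    have "b' (b (E y)) = E y - C y"
      using C(2)[of "E y"] E(3)[of y] by (simp add: algebra_simps)
    then show ?thesis by (simp add: s_def s'_def E.diff E(2))
  qed
  then have "op_roots s s' Ps E"
    using adj Ps E(1) by (simp add: op_roots_def)
  then have "ball_coordinate B (op_graph s)"
    unfolding ball_coordinate_def using bc E(2)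
    by (intro conjI exI[of _ s] exI[of _ s'] exI[of _ Ps] exI[of _ E])
      (simp_all add: b_def s'_def)
  moreover have "op_graph s \<in> closed_ops"
    by (rule op_graph_closed_ops[OF adjoint_pairD(1)[OF adj]])
  ultimately show ?thesis using that by blast
qed

section \<open>Compactness\<close>

lemma norm_power2_convex_combination:
  fixes a b :: "'a::real_inner"
  assumes "0 \<le> u" "0 \<le> v" "u + v = 1"
  shows "(norm (u *\<^sub>R a + v *\<^sub>R b))\<^sup>2 \<le> u * (norm a)\<^sup>2 + v * (norm b)\<^sup>2"
proof -
  have v: "v = 1 - u" using assms(3) by simp
  have "u * (norm a)\<^sup>2 + v * (norm b)\<^sup>2 - (norm (u *\<^sub>R a + v *\<^sub>R b))\<^sup>2 = u * v * (norm (a - b))\<^sup>2"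
    unfolding power2_norm_eq_inner v
    by (simp add: inner_simps inner_commute algebra_simps power2_eq_square)
  then show ?thesis
    using assms by (metis diff_ge_0_iff_ge mult_nonneg_nonneg zero_le_power2)
qed

lemma coordinate_ball_closed:
  assumes "op_roots t t' P Q"
  shows "closed (coordinate_ball t Q r)"
proof -
  interpret op_roots t t' P Q by fact
  have "coordinate_ball t Q r = {B. bounded_clinear (blinfun_apply B)} \<inter>
    (\<Inter>x. {B. (norm (blinfun_apply B x))\<^sup>2 +
      (1 - (tanh r)\<^sup>2) * (norm (Q x - t (blinfun_apply B x)))\<^sup>2 \<le> (norm x)\<^sup>2})"
    by (auto simp: coordinate_ball_def)
  moreover have "closed (\<Inter>x. {B. (norm (blinfun_apply B x))\<^sup>2 +
      (1 - (tanh r)\<^sup>2) * (norm (Q x - t (blinfun_apply B x)))\<^sup>2 \<le> (norm x)\<^sup>2})"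
    by (intro closed_INT ballI closed_Collect_le continuous_intros t.continuous_on)
  ultimately show ?thesis
    by (simp add: closed_Int closed_bounded_clinear)
qed

lemma coordinate_ball_convex:
  assumes "op_roots t t' P Q"
  shows "convex (coordinate_ball t Q r)"
proof (rule convexI)
  interpret op_roots t t' P Q by fact
  fix A B and u v :: real
  assume AB: "A \<in> coordinate_ball t Q r" "B \<in> coordinate_ball t Q r"
    and uv: "0 \<le> u" "0 \<le> v" "u + v = 1"
  let ?k = "1 - (tanh r)\<^sup>2"
  let ?C = "u *\<^sub>R A + v *\<^sub>R B"
  have k: "0 \<le> ?k" using tanh_power2_less_1[of r] by simp
  have C: "blinfun_apply ?C = (\<lambda>x. u *\<^sub>R blinfun_apply A x + v *\<^sub>R blinfun_apply B x)"
    by (simp add: fun_eq_iff blinfun.bilinear_simps)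
  have "bounded_clinear (blinfun_apply ?C)"
    unfolding C using AB by (intro bounded_clinear_intros) (simp_all add: coordinate_ball_def)
  moreover have "(norm (blinfun_apply ?C x))\<^sup>2 + ?k * (norm (Q x - t (blinfun_apply ?C x)))\<^sup>2 \<le> (norm x)\<^sup>2"
    for x
  proof -
    let ?a = "blinfun_apply A x" and ?b = "blinfun_apply B x"
    \<comment> \<open>Splitting Q x with the weights shows that Q x - t (B x) is affine in
      \<open>B\<close>.\<close>
    have "Q x = u *\<^sub>R Q x + v *\<^sub>R Q x"
      using uv(3) by (simp flip: scaleR_left_distrib)
    then have eq: "Q x - t (u *\<^sub>R ?a + v *\<^sub>R ?b) = u *\<^sub>R (Q x - t ?a) + v *\<^sub>R (Q x - t ?b)"
      by (simp add: t.add t.scaleR scaleR_diff_right)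
    have "(norm (u *\<^sub>R ?a + v *\<^sub>R ?b))\<^sup>2 + ?k * (norm (Q x - t (u *\<^sub>R ?a + v *\<^sub>R ?b)))\<^sup>2
        \<le> (u * (norm ?a)\<^sup>2 + v * (norm ?b)\<^sup>2) +
          ?k * (u * (norm (Q x - t ?a))\<^sup>2 + v * (norm (Q x - t ?b))\<^sup>2)"
      unfolding eq by (intro add_mono mult_left_mono norm_power2_convex_combination uv k)
    also have "\<dots> = u * ((norm ?a)\<^sup>2 + ?k * (norm (Q x - t ?a))\<^sup>2) +
        v * ((norm ?b)\<^sup>2 + ?k * (norm (Q x - t ?b))\<^sup>2)"
      by (simp add: algebra_simps)
    also have "\<dots> \<le> u * (norm x)\<^sup>2 + v * (norm x)\<^sup>2"
      using AB uv by (intro add_mono mult_left_mono) (auto simp: coordinate_ball_def)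
    also have "\<dots> = (norm x)\<^sup>2"
      using uv(3) by (simp flip: distrib_right)
    finally show ?thesis by (simp add: C)
  qed
  ultimately show "?C \<in> coordinate_ball t Q r"
    by (simp add: coordinate_ball_def)
qed

lemma coordinate_ball_norm_le:
  assumes "B \<in> coordinate_ball t Q r"
  shows "norm (blinfun_apply B x) \<le> norm x"
proof (rule power2_le_imp_le)
  have "0 \<le> (1 - (tanh r)\<^sup>2) * (norm (Q x - t (blinfun_apply B x)))\<^sup>2"
    using tanh_power2_less_1[of r] by simp
  moreover have "(norm (blinfun_apply B x))\<^sup>2 +
      (1 - (tanh r)\<^sup>2) * (norm (Q x - t (blinfun_apply B x)))\<^sup>2 \<le> (norm x)\<^sup>2"
    using assms by (simp add: coordinate_ball_def)
  ultimately show "(norm (blinfun_apply B x))\<^sup>2 \<le> (norm x)\<^sup>2"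
    by linarith
qed simp

text \<open>The last clause makes membership in \<open>A\<close> a property of the coordinate alone,
  so intersections of balls become intersections of their coordinate sets.\<close>

lemma admissible_ball_coordinates:
  fixes A :: "('h::complex_hilbert_space, 'k::complex_hilbert_space) operator set"
  assumes fin: "\<exists>B :: 'k set. finite B \<and> span B = UNIV"
    and A: "A \<in> admissible_sets closed_ops op_dist"
  obtains G where "closed G" "convex G" "\<And>B x. B \<in> G \<Longrightarrow> norm (blinfun_apply B x) \<le> norm x"
    "\<And>B. B \<in> G \<Longrightarrow> \<exists>S\<in>closed_ops. ball_coordinate B S"
    "\<And>B S. S \<in> closed_ops \<Longrightarrow> ball_coordinate B S \<Longrightarrow> S \<in> A \<longleftrightarrow> B \<in> G"
proof -
  define balls where "balls = {{S \<in> closed_ops. op_dist T S \<le> r} | (T :: ('h, 'k) operator) r.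
    T \<in> closed_ops \<and> 0 \<le> r}"
  obtain \<B> where \<B>: "A = \<Inter>\<B>" "\<B> \<noteq> {}" "\<B> \<subseteq> balls"
    using A unfolding admissible_sets_def balls_def by blast
  define good where "good D G \<longleftrightarrow> closed G \<and> convex G \<and>
      (\<forall>B\<in>G. \<forall>x. norm (blinfun_apply B x) \<le> norm x) \<and>
      (\<forall>B\<in>G. \<exists>S\<in>closed_ops. ball_coordinate B S) \<and>
      (\<forall>S\<in>closed_ops. \<forall>B. ball_coordinate B S \<longrightarrow> (S \<in> D \<longleftrightarrow> B \<in> G))"
    for D :: "('h, 'k) operator set" and G
  have "\<exists>G. good D G" if D_in: "D \<in> \<B>" for D
  proof -
    obtain T r where D: "D = {S \<in> closed_ops. op_dist T S \<le> r}" "T \<in> closed_ops" "0 \<le> r"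
      using D_in \<B>(3) unfolding balls_def by blast
    obtain t t' where t: "T = op_graph t" "adjoint_pair t t'"
      using closed_ops_finite_codomain[OF fin D(2)] by metis
    obtain P Q where roots: "op_roots t t' P Q"
      using op_roots_exists[OF t(2)] by metis
    show ?thesis
      unfolding good_def
    proof (intro exI[of _ "coordinate_ball t Q r"] conjI ballI allI impI)
      show "\<exists>S\<in>closed_ops. ball_coordinate B S" if "B \<in> coordinate_ball t Q r" for B
        using ball_coordinate_surj[OF fin roots that] by metis
      show "S \<in> D \<longleftrightarrow> B \<in> coordinate_ball t Q r" if "S \<in> closed_ops" "ball_coordinate B S" for S B
        using ball_coordinate_op_dist[OF fin roots that(2) D(3)] that(1) by (simp add: D(1) t(1))
    qed (use roots in \<open>auto intro: coordinate_ball_closed coordinate_ball_convex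
          coordinate_ball_norm_le\<close>)
  qed
  then obtain G where "\<And>D. D \<in> \<B> \<Longrightarrow> good D (G D)" by metis
  then have G: "\<And>D. D \<in> \<B> \<Longrightarrow> closed (G D)" "\<And>D. D \<in> \<B> \<Longrightarrow> convex (G D)"
    "\<And>D B x. D \<in> \<B> \<Longrightarrow> B \<in> G D \<Longrightarrow> norm (blinfun_apply B x) \<le> norm x"
    "\<And>D B. D \<in> \<B> \<Longrightarrow> B \<in> G D \<Longrightarrow> \<exists>S\<in>closed_ops. ball_coordinate B S"
    "\<And>D B S. D \<in> \<B> \<Longrightarrow> S \<in> closed_ops \<Longrightarrow> ball_coordinate B S \<Longrightarrow> S \<in> D \<longleftrightarrow> B \<in> G D"
    unfolding good_def by blast+
  show ?thesis
  \<comment> \<open>As the family is nonempty, each point of the intersection lies in some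
    coordinate ball, which supplies its norm bound and its operator.\<close>
  proof (rule that[of "\<Inter>D\<in>\<B>. G D"])
    show "closed (\<Inter>D\<in>\<B>. G D)" using G(1) by (intro closed_INT) blast
    show "convex (\<Inter>D\<in>\<B>. G D)" using G(2) by (intro convex_INT) blast
    show "norm (blinfun_apply B x) \<le> norm x" if "B \<in> (\<Inter>D\<in>\<B>. G D)" for B x
      using that \<B>(2) G(3) by blast
    show "\<exists>S\<in>closed_ops. ball_coordinate B S" if "B \<in> (\<Inter>D\<in>\<B>. G D)" for B
      using that \<B>(2) G(4) by blast
    show "S \<in> A \<longleftrightarrow> B \<in> (\<Inter>D\<in>\<B>. G D)" if "S \<in> closed_ops" "ball_coordinate B S" for B S
      using that G(5) unfolding \<B>(1) by blast
  qed
qed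

lemma admissible_subset_closed_ops: "A \<in> admissible_sets M d \<Longrightarrow> A \<subseteq> M"
  unfolding admissible_sets_def by blast

theorem corollary3p4:
  assumes "\<exists>B :: 'k set. finite B \<and> module.span (scaleC :: complex \<Rightarrow> 'k \<Rightarrow> 'k) B = UNIV"
  shows "compact_family (admissible_sets
    (closed_ops :: ('h::complex_hilbert_space, 'k::complex_hilbert_space) operator set) op_dist)"
proof -
  have fin: "\<exists>B :: 'k set. finite B \<and> span B = UNIV"
    using assms finite_span_scaleC_imp_scaleR by blast
  obtain E :: "'k set" where E: "finite E" "\<And>e. e \<in> E \<Longrightarrow> norm e = 1"
    "\<And>x. x = (\<Sum>e\<in>E. inner x e *\<^sub>R e)"
    using orthonormal_basis_exists[OF fin] by metis
  \<comment> \<open>The squared Hilbert-Schmidt norm. Closedness and completeness still refer to the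
    operator norm; \<open>N\<close> contributes the parallelogram law.\<close>
  define N :: "('k \<Rightarrow>\<^sub>L 'h) \<Rightarrow> real" where "N B = (\<Sum>e\<in>E. (norm (blinfun_apply B e))\<^sup>2)" for B
  \<comment> \<open>The summand 1 keeps the factor positive when K = 0 and \<open>E\<close> is
    empty.\<close>
  have norm_le_N: "(norm B)\<^sup>2 \<le> (real (card E) + 1) * N B" for B
  proof -
    have "norm B \<le> (\<Sum>e\<in>E. norm (blinfun_apply B e))"
    proof (rule norm_blinfun_bound)
      show "norm (blinfun_apply B x) \<le> (\<Sum>e\<in>E. norm (blinfun_apply B e)) * norm x" for x
        using norm_linear_le_orthonormal[OF bounded_linear.linear[OF blinfun.bounded_linear_right]
            E(2,3), of B x]
        by (simp add: mult.commute)
    qed (simp add: sum_nonneg)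
    then have "(norm B)\<^sup>2 \<le> (\<Sum>e\<in>E. norm (blinfun_apply B e))\<^sup>2"
      by (simp add: power_mono)
    also have "\<dots> \<le> N B * real (card E)"
      unfolding N_def by (rule sum_squared_le_sum_of_squares)
    also have "\<dots> \<le> (real (card E) + 1) * N B"
      by (simp add: N_def algebra_simps sum_nonneg)
    finally show ?thesis .
  qed
  have parallelogram: "N (X - Y) = 2 * N X + 2 * N Y - 4 * N ((1/2) *\<^sub>R (X + Y))" for X Y
  proof -
    have "(norm (x - y))\<^sup>2 = 2 * (norm x)\<^sup>2 + 2 * (norm y)\<^sup>2 - 4 * (norm ((1/2) *\<^sub>R (x + y)))\<^sup>2"
      for x y :: 'h
      unfolding power2_norm_eq_inner by (simp add: inner_simps inner_commute field_simps)
    then show ?thesis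
      by (simp add: N_def blinfun.bilinear_simps sum.distrib sum_subtractf sum_distrib_left)
  qed
  have cont: "continuous_on UNIV N"
    unfolding N_def[abs_def] by (intro continuous_intros)
  show ?thesis
    unfolding compact_family_def
  proof (intro ballI impI)
    fix \<C> assume chains: "\<C> \<in> chains (admissible_sets (closed_ops :: ('h, 'k) operator set) op_dist - {{}})"
      and ne: "\<C> \<noteq> {}"
    have adm: "A \<in> admissible_sets closed_ops op_dist" "A \<noteq> {}" if "A \<in> \<C>" for A
      using chains that by (auto simp: chains_def)
    have chain: "A \<subseteq> A' \<or> A' \<subseteq> A" if "A \<in> \<C>" "A' \<in> \<C>" for A A'
      using chains that by (auto simp: chains_def chain_subset_def)
    define \<Phi> where "\<Phi> A = {B. \<exists>S\<in>A. ball_coordinate B S}" for A :: "('h, 'k) operator set"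
    have sub: "A \<subseteq> closed_ops" if "A \<in> \<C>" for A
      using adm(1)[OF that] by (rule admissible_subset_closed_ops)
    \<comment> \<open>The last conjunct brings points back: an operator sharing its coordinate with
      some member of \<open>A\<close> is itself in \<open>A\<close>.\<close>
    have \<Phi>: "closed (\<Phi> A) \<and> convex (\<Phi> A) \<and> (\<forall>B\<in>\<Phi> A. \<forall>x. norm (blinfun_apply B x) \<le> norm x) \<and>
        (\<forall>S\<in>closed_ops. \<forall>B\<in>\<Phi> A. ball_coordinate B S \<longrightarrow> S \<in> A)" if A: "A \<in> \<C>" for A
    proof -
      obtain G where G: "closed G" "convex G" "\<And>B x. B \<in> G \<Longrightarrow> norm (blinfun_apply B x) \<le> norm x"
        "\<And>B. B \<in> G \<Longrightarrow> \<exists>S\<in>closed_ops. ball_coordinate B S"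
        "\<And>B S. S \<in> closed_ops \<Longrightarrow> ball_coordinate B S \<Longrightarrow> S \<in> A \<longleftrightarrow> B \<in> G"
        by (rule admissible_ball_coordinates[OF fin adm(1)[OF A]]) blast
      have "\<Phi> A = G"
        using G(4,5) sub[OF A] unfolding \<Phi>_def by blast
      then show ?thesis using G by blast
    qed
    have "\<Inter>(\<Phi> ` \<C>) \<noteq> {}"
    proof (rule closed_convex_chain_Inter[OF cont parallelogram norm_le_N])
      show "\<Phi> ` \<C> \<noteq> {}" using ne by simp
      show "X \<subseteq> Y \<or> Y \<subseteq> X" if "X \<in> \<Phi> ` \<C>" "Y \<in> \<Phi> ` \<C>" for X Y
        using that chain unfolding \<Phi>_def by blast
      show "closed X" "convex X" if "X \<in> \<Phi> ` \<C>" for X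
        using that \<Phi> by auto
      show "X \<noteq> {}" if X: "X \<in> \<Phi> ` \<C>" for X
      proof -
        obtain A where A: "A \<in> \<C>" "X = \<Phi> A" using X by blast
        obtain S where S: "S \<in> A" using adm(2)[OF A(1)] by blast
        obtain B where "ball_coordinate B S"
          using ball_coordinate_exists[OF fin] sub[OF A(1)] S by blast
        then show ?thesis using A(2) S by (auto simp: \<Phi>_def)
      qed
      show "N B \<le> (\<Sum>e\<in>E. (norm e)\<^sup>2)" if "X \<in> \<Phi> ` \<C>" "B \<in> X" for X B
        unfolding N_def using that \<Phi> by (intro sum_mono power_mono) auto
    qed (simp_all add: N_def sum_nonneg add_nonneg_pos)
    then obtain B where B: "\<And>A. A \<in> \<C> \<Longrightarrow> B \<in> \<Phi> A" by blast
    obtain A where A: "A \<in> \<C>" using ne by blast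
    \<comment> \<open>An operator with the common coordinate, taken from one member of the chain,
      then lies in every member.\<close>
    obtain S where S: "S \<in> A" "ball_coordinate B S" using B[OF A] by (auto simp: \<Phi>_def)
    have "S \<in> A'" if "A' \<in> \<C>" for A'
      using \<Phi>[OF that] B[OF that] S(2) sub[OF A] S(1) by blast
    then show "\<Inter>\<C> \<noteq> {}" by blast
  qed
qed

end
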